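(* Let $\Omega\subset\mathbb{R}^3$ be a periodic box, $L_1>0$, $L_4\in\mathbb{R}$, $\alpha,\beta\in\mathbb{R}$, $\gamma>0$. Let $\kappa_2\ge\frac{L_4^2}{2L_1}$, $a>0$ (sufficiently large depending on the coefficients), $b=\frac{\beta^2}{\gamma^2}-\frac{2(\alpha-\kappa_2)}{\gamma}$ with $b<a^2$, $C_f=|\alpha|+|\beta|a+\gamma a^2+\gamma|b|$, and $\kappa_1\ge\frac{(\kappa_2+C_f)^2}{\gamma(a^2-b)}$. Let $Q_0\in\mathcal{Z}$ with $\|Q_0\|_{\mathcal{Z}}^2\le a^2$, let $\tau>0$, and let $\{Q_m\}_{m\ge0}$ be generated either by the ETD1 scheme or by the ETDRK2 scheme (defined below) starting from $Q_0$. Then $\|Q_m\|_{\mathcal{Z}}^2\le a^2$ for all $m\ge0$.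
   Context: $\mathbb{R}^{3\times3}_{s,0}$: real symmetric traceless $3\times3$ matrices; $\mathcal{Z}=L^\infty(\bar\Omega;\mathbb{R}^{3\times3}_{s,0})$ with $\|Q\|_{\mathcal{Z}}=\max_x\|Q(x)\|_F$. Matrix curl $(\nabla\times Q)_{ij}=\sum_{k,l}\varepsilon_{ikl}\partial_kQ_{lj}$; periodic boundary conditions. Define $\mathcal{L}Q=L_1\Delta Q-\frac{L_4}{2}(\nabla\times Q+(\nabla\times Q)^T)-\kappa_1Q-\kappa_2Q$, $f(Q)=-\alpha Q+\beta(Q^2-\frac13\operatorname{tr}(Q^2)I)-\gamma\operatorname{tr}(Q^2)Q$, $\mathcal{N}(Q)=\kappa_1Q+\kappa_2Q+f(Q)$. ETD1 scheme: $Q_{m+1}=e^{\tau\mathcal{L}}Q_m+\int_0^\tau e^{(\tau-s)\mathcal{L}}\mathcal{N}(Q_m)\,ds$. ETDRK2 scheme: $\widetilde Q_{m+1}=e^{\tau\mathcal{L}}Q_m+\int_0^\tau e^{(\tau-s)\mathcal{L}}\mathcal{N}(Q_m)\,ds$, then $Q_{m+1}=e^{\tau\mathcal{L}}Q_m+\int_0^\tau e^{(\tau-s)\mathcal{L}}\big((1-\frac{s}{\tau})\mathcal{N}(Q_m)+\frac{s}{\tau}\mathcal{N}(\widetilde Q_{m+1})\big)ds$. *)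

theory Defs
  imports "HOL-Analysis.Analysis"
begin

text \<open>Real 3x3 matrices are elements of real^3^3, complex ones of complex^3^3.
  Matrix product is (**); note that (*) on vec is componentwise.\<close>

type_synonym rmat = "real^3^3"
type_synonym cmat = "complex^3^3"

definition Omega :: "real^3 \<Rightarrow> (real^3) set" where
  "Omega l = cbox 0 l"

definition frob :: "rmat \<Rightarrow> real" where
  "frob A = sqrt (\<Sum>i\<in>UNIV. \<Sum>j\<in>UNIV. (A $ i $ j)\<^sup>2)"

definition sym_traceless :: "rmat \<Rightarrow> bool" where
  "sym_traceless A \<longleftrightarrow> transpose A = A \<and> trace A = 0"

definition fbulk :: "real \<Rightarrow> real \<Rightarrow> real \<Rightarrow> rmat \<Rightarrow> rmat" where
  "fbulk \<alpha> \<beta> \<gamma> A =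
     (- \<alpha>) *\<^sub>R A
     + \<beta> *\<^sub>R (A ** A - (trace (A ** A) / 3) *\<^sub>R mat 1)
     - (\<gamma> * trace (A ** A)) *\<^sub>R A"

definition Nop :: "real \<Rightarrow> real \<Rightarrow> real \<Rightarrow> real \<Rightarrow> real \<Rightarrow> rmat \<Rightarrow> rmat" where
  "Nop \<kappa>1 \<kappa>2 \<alpha> \<beta> \<gamma> A = \<kappa>1 *\<^sub>R A + \<kappa>2 *\<^sub>R A + fbulk \<alpha> \<beta> \<gamma> A"

definition levi :: "3 \<Rightarrow> 3 \<Rightarrow> 3 \<Rightarrow> real" where
  "levi i k l =
    (if (i, k, l) \<in> {(1, 2, 3), (2, 3, 1), (3, 1, 2)} then 1
     else if (i, k, l) \<in> {(1, 3, 2), (3, 2, 1), (2, 1, 3)} then -1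
     else 0)"

definition wavevec :: "real^3 \<Rightarrow> int^3 \<Rightarrow> real^3" where
  "wavevec l k = (\<chi> j. 2 * pi * real_of_int (k $ j) / l $ j)"

text \<open>Fourier coefficient of a scalar function on the periodic box (convention
  g(x) = sum_k ghat(k) exp(i xi_k . x)).\<close>
definition fcoef :: "real^3 \<Rightarrow> (real^3 \<Rightarrow> complex) \<Rightarrow> int^3 \<Rightarrow> complex" where
  "fcoef l g k =
     complex_of_real (1 / (\<Prod>j\<in>UNIV. l $ j)) *
     (LINT x : Omega l | lborel. g x * exp (- \<i> * complex_of_real (wavevec l k \<bullet> x)))"

definition mcoef :: "real^3 \<Rightarrow> (real^3 \<Rightarrow> rmat) \<Rightarrow> int^3 \<Rightarrow> cmat" where
  "mcoef l Q k = (\<chi> i j. fcoef l (\<lambda>x. complex_of_real (Q x $ i $ j)) k)"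

text \<open>Fourier symbol of the linear operator
  L Q = L1 Lap Q - L4/2 (curl Q + (curl Q)^T) - kappa1 Q - kappa2 Q,
  with (curl Q)_ij = sum_{k,l} eps_ikl d_k Q_lj and d_k acting as i xi_k.\<close>
definition curl_sym :: "real^3 \<Rightarrow> cmat \<Rightarrow> cmat" where
  "curl_sym \<xi> A = (\<chi> i j. \<Sum>k\<in>UNIV. \<Sum>m\<in>UNIV.
        complex_of_real (levi i k m) * \<i> * complex_of_real (\<xi> $ k) * A $ m $ j)"

definition Lsym :: "real \<Rightarrow> real \<Rightarrow> real \<Rightarrow> real \<Rightarrow> real^3 \<Rightarrow> cmat \<Rightarrow> cmat" where
  "Lsym L1 L4 \<kappa>1 \<kappa>2 \<xi> A =
     (- (L1 * (norm \<xi>)\<^sup>2)) *\<^sub>R A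
     - (L4 / 2) *\<^sub>R (curl_sym \<xi> A + transpose (curl_sym \<xi> A))
     - \<kappa>1 *\<^sub>R A - \<kappa>2 *\<^sub>R A"

definition expop :: "real \<Rightarrow> (cmat \<Rightarrow> cmat) \<Rightarrow> cmat \<Rightarrow> cmat" where
  "expop t M A = (\<Sum>n. (t ^ n / fact n) *\<^sub>R ((M ^^ n) A))"

text \<open>Well-posedness requirement for an iterate (automatically true for elements of Z):
  the components of Q and of N(Q) are integrable on the box, so that their Fourier
  coefficients are defined and determine them almost everywhere.\<close>
definition admissible :: "real^3 \<Rightarrow> real \<Rightarrow> real \<Rightarrow> real \<Rightarrow> real \<Rightarrow> real
                          \<Rightarrow> (real^3 \<Rightarrow> rmat) \<Rightarrow> bool" where
  "admissible l \<kappa>1 \<kappa>2 \<alpha> \<beta> \<gamma> Q \<longleftrightarrow>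
     (\<forall>i j. set_integrable lborel (Omega l) (\<lambda>x. Q x $ i $ j)) \<and>
     (\<forall>i j. set_integrable lborel (Omega l) (\<lambda>x. Nop \<kappa>1 \<kappa>2 \<alpha> \<beta> \<gamma> (Q x) $ i $ j))"

text \<open>One ETD1 step  Qn = e^{tau L} Qm + int_0^tau e^{(tau-s)L} N(Qm) ds,
  expressed mode by mode in Fourier space.\<close>
definition etd1_step :: "real^3 \<Rightarrow> real \<Rightarrow> real \<Rightarrow> real \<Rightarrow> real \<Rightarrow> real \<Rightarrow> real \<Rightarrow> real \<Rightarrow> real
                         \<Rightarrow> (real^3 \<Rightarrow> rmat) \<Rightarrow> (real^3 \<Rightarrow> rmat) \<Rightarrow> bool" where
  "etd1_step l L1 L4 \<kappa>1 \<kappa>2 \<alpha> \<beta> \<gamma> \<tau> Qm Qn \<longleftrightarrow>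
     (\<forall>k. mcoef l Qn k =
        expop \<tau> (Lsym L1 L4 \<kappa>1 \<kappa>2 (wavevec l k)) (mcoef l Qm k)
        + integral {0..\<tau>} (\<lambda>s. expop (\<tau> - s) (Lsym L1 L4 \<kappa>1 \<kappa>2 (wavevec l k))
              (mcoef l (\<lambda>x. Nop \<kappa>1 \<kappa>2 \<alpha> \<beta> \<gamma> (Qm x)) k)))"

text \<open>Second stage of ETDRK2:
  Qn = e^{tau L} Qm + int_0^tau e^{(tau-s)L} ((1-s/tau) N(Qm) + (s/tau) N(Qt)) ds.\<close>
definition etdrk2_step :: "real^3 \<Rightarrow> real \<Rightarrow> real \<Rightarrow> real \<Rightarrow> real \<Rightarrow> real \<Rightarrow> real \<Rightarrow> real \<Rightarrow> real
                         \<Rightarrow> (real^3 \<Rightarrow> rmat) \<Rightarrow> (real^3 \<Rightarrow> rmat) \<Rightarrow> (real^3 \<Rightarrow> rmat) \<Rightarrow> bool" where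
  "etdrk2_step l L1 L4 \<kappa>1 \<kappa>2 \<alpha> \<beta> \<gamma> \<tau> Qm Qt Qn \<longleftrightarrow>
     (\<forall>k. mcoef l Qn k =
        expop \<tau> (Lsym L1 L4 \<kappa>1 \<kappa>2 (wavevec l k)) (mcoef l Qm k)
        + integral {0..\<tau>} (\<lambda>s. expop (\<tau> - s) (Lsym L1 L4 \<kappa>1 \<kappa>2 (wavevec l k))
              ((1 - s / \<tau>) *\<^sub>R mcoef l (\<lambda>x. Nop \<kappa>1 \<kappa>2 \<alpha> \<beta> \<gamma> (Qm x)) k
               + (s / \<tau>) *\<^sub>R mcoef l (\<lambda>x. Nop \<kappa>1 \<kappa>2 \<alpha> \<beta> \<gamma> (Qt x)) k)))"

definition is_etd1_seq where
  "is_etd1_seq l L1 L4 \<kappa>1 \<kappa>2 \<alpha> \<beta> \<gamma> \<tau> (Q :: nat \<Rightarrow> real^3 \<Rightarrow> rmat) \<longleftrightarrow>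
     (\<forall>m. admissible l \<kappa>1 \<kappa>2 \<alpha> \<beta> \<gamma> (Q m)
          \<and> etd1_step l L1 L4 \<kappa>1 \<kappa>2 \<alpha> \<beta> \<gamma> \<tau> (Q m) (Q (Suc m)))"

definition is_etdrk2_seq where
  "is_etdrk2_seq l L1 L4 \<kappa>1 \<kappa>2 \<alpha> \<beta> \<gamma> \<tau> (Q :: nat \<Rightarrow> real^3 \<Rightarrow> rmat)
                 (Qt :: nat \<Rightarrow> real^3 \<Rightarrow> rmat) \<longleftrightarrow>
     (\<forall>m. admissible l \<kappa>1 \<kappa>2 \<alpha> \<beta> \<gamma> (Q m)
          \<and> admissible l \<kappa>1 \<kappa>2 \<alpha> \<beta> \<gamma> (Qt (Suc m))
          \<and> etd1_step l L1 L4 \<kappa>1 \<kappa>2 \<alpha> \<beta> \<gamma> \<tau> (Q m) (Qt (Suc m))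
          \<and> etdrk2_step l L1 L4 \<kappa>1 \<kappa>2 \<alpha> \<beta> \<gamma> \<tau> (Q m) (Qt (Suc m)) (Q (Suc m)))"

text \<open>Membership in Z: measurable on the box with symmetric traceless values a.e.
  (essential boundedness is implied by the norm bound assumed separately).\<close>
definition inZ :: "real^3 \<Rightarrow> (real^3 \<Rightarrow> rmat) \<Rightarrow> bool" where
  "inZ l Q \<longleftrightarrow> set_borel_measurable lborel (Omega l) Q \<and>
               (AE x in lborel. x \<in> Omega l \<longrightarrow> sym_traceless (Q x))"

end

theory Submission
  imports Defs
begin

text \<open>
  Write \<open>S(t)\<close> for the semigroup of the linear part. For a trigonometric polynomial \<open>u\<close>
  with symmetric values, the parabolic maximum principle applied to
  \<open>exp (2 \<kappa>1 t) |S(t) u|^2\<close> shows that \<open>S(t)\<close> contracts the supremum norm by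
  \<open>exp (- \<kappa>1 t)\<close>: at a spatial maximum the curl term is absorbed by \<open>L1 |grad u|^2\<close> and
  \<open>\<kappa>2 |u|^2\<close>, because \<open>|curl u|^2 \<le> 2 |grad u|^2\<close>.

  General iterates are reduced to trigonometric polynomials by Fejer means. The kernel is positive
  with mean one, so the means of \<open>Q\<close> and \<open>N(Q)\<close> inherit the bounds \<open>a\<close> and \<open>\<kappa>1 a\<close>, and the
  mean of the next iterate is bounded by
  \<open>exp (- \<kappa>1 \<tau>) a + (1 - exp (- \<kappa>1 \<tau>)) a = a\<close>. Conversely, a bound on all Fejer means of an
  integrable function bounds the function almost everywhere: by Korovkin's argument, testing
  against the kernel's trigonometric moments makes the means of a continuous test function converge
  uniformly. The same statement with bound zero shows that symmetry is passed on to the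
  next iterate.
\<close>

section \<open>Complex matrices\<close>

text \<open>A step of the scheme prescribes only the Fourier coefficients of the next field, and
  that field is a priori merely integrable, so it can be neither evaluated nor differentiated at a
  point. Fejer means get around this because they, like the semigroup, act mode by mode and hence
  commute with it. They do not commute with \<open>Nop\<close>, so the nonlinearity is bounded
  pointwise before it is averaged, and the bound on the means of a new iterate has to be carried
  back to the field itself before the next step. Symmetry of the values must be propagated as well:
  without it the two transposed curl terms may contribute differently at a maximum, and the trace of
  Q^2 need not be |Q|^2. As for the constants, b marks the value of |Q|^2 above which the reaction,
  with \<kappa>2 included, is estimated to point inwards, and \<kappa>2 + Cf dominates each
  coefficient of the reaction for |Q| \<le> a.\<close>

lemma inner_cmat: "(A::cmat) \<bullet> B = (\<Sum>i\<in>UNIV. \<Sum>j\<in>UNIV. A $ i $ j \<bullet> B $ i $ j)"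
  by (simp add: inner_vec_def)

text \<open>The inner product of the type class is the real part of the Hermitian one, so complex
  matrices form a real Euclidean space with the Frobenius norm. Real calculus of |u|^2 therefore
  applies to complex trigonometric sums.\<close>

lemma norm_sq_cmat: "(norm (A::cmat))\<^sup>2 = (\<Sum>i\<in>UNIV. \<Sum>j\<in>UNIV. (norm (A $ i $ j))\<^sup>2)"
  by (simp add: power2_norm_eq_inner inner_vec_def)

lemma inner_transpose_cmat: "(A::cmat) \<bullet> transpose B = transpose A \<bullet> B"
  unfolding inner_cmat transpose_def by (subst sum.swap) simp

text \<open>Phase factors are complex, while the vector space structure of \<open>cmat\<close>
  offers only real scalars. As a bounded bilinear map it inherits the rules for derivatives,
  continuity and integrals.\<close>

definition cscale :: "complex \<Rightarrow> cmat \<Rightarrow> cmat" where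
  "cscale c A = (\<chi> i j. c * A $ i $ j)"

lemma cscale_nth [simp]: "cscale c A $ i $ j = c * A $ i $ j"
  by (simp add: cscale_def)

lemma norm_cscale [simp]: "norm (cscale c A) = norm c * norm A"
proof -
  have "(norm (cscale c A))\<^sup>2 = (norm c * norm A)\<^sup>2"
    by (simp add: norm_sq_cmat power_mult_distrib norm_mult sum_distrib_left)
  then show ?thesis by (simp add: power2_eq_iff_nonneg)
qed

lemma bounded_bilinear_cscale: "bounded_bilinear cscale"
proof
  show "\<exists>K. \<forall>a b. norm (cscale a b) \<le> norm a * norm b * K"
    by (rule exI[of _ 1]) simp
qed (simp_all add: vec_eq_iff algebra_simps)

interpretation cscale: bounded_bilinear cscale
  by (rule bounded_bilinear_cscale)

lemma transpose_cscale: "transpose (cscale c A) = cscale c (transpose A)"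
  by (simp add: vec_eq_iff transpose_def)

lemma linear_transpose_cmat: "linear (transpose :: cmat \<Rightarrow> cmat)"
  by (rule linearI) (simp_all add: vec_eq_iff transpose_def)

lemma linear_Lsym: "linear (Lsym L1 L4 \<kappa>1 \<kappa>2 \<xi>)"
  by (rule linearI)
    (simp_all add: vec_eq_iff Lsym_def curl_sym_def transpose_def algebra_simps sum.distrib
      scaleR_sum_right)

text \<open>The curl enters only through its sum with its own transpose.\<close>

lemma Lsym_symmetric:
  "transpose A = A \<Longrightarrow> transpose (Lsym L1 L4 \<kappa>1 \<kappa>2 \<xi> A) = Lsym L1 L4 \<kappa>1 \<kappa>2 \<xi> A"
  by (simp add: Lsym_def vec_eq_iff transpose_def algebra_simps)

section \<open>Exponentials of linear maps\<close>

lemma norm_funpow_linear_le: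
  fixes M :: "cmat \<Rightarrow> cmat"
  assumes "\<And>A. norm (M A) \<le> B * norm A" "B \<ge> 0"
  shows "norm ((M ^^ n) A) \<le> B ^ n * norm A"
proof (induction n)
  case (Suc n)
  have "norm ((M ^^ Suc n) A) \<le> B * norm ((M ^^ n) A)" using assms(1) by simp
  also have "\<dots> \<le> B * (B ^ n * norm A)" using Suc assms(2) by (intro mult_left_mono)
  finally show ?case by simp
qed simp

lemma summable_expop:
  fixes M :: "cmat \<Rightarrow> cmat"
  assumes "linear M"
  shows "summable (\<lambda>n. (t ^ n / fact n) *\<^sub>R ((M ^^ n) A))"
proof -
  obtain B where B: "B > 0" "\<And>A. norm (M A) \<le> B * norm A"
    using linear_bounded_pos[OF assms] by blast
  show ?thesis
  proof (rule summable_comparison_test'[where N=0])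
    show "summable (\<lambda>n. norm A * (inverse (fact n) * (\<bar>t\<bar> * B) ^ n))"
      by (intro summable_mult summable_exp)
    fix n :: nat
    have "norm ((t ^ n / fact n) *\<^sub>R ((M ^^ n) A)) = \<bar>t\<bar> ^ n / fact n * norm ((M ^^ n) A)"
      by (simp add: power_abs)
    also have "\<dots> \<le> \<bar>t\<bar> ^ n / fact n * (B ^ n * norm A)"
      using norm_funpow_linear_le[of M B] B by (intro mult_left_mono) auto
    finally show "norm ((t ^ n / fact n) *\<^sub>R ((M ^^ n) A))
        \<le> norm A * (inverse (fact n) * (\<bar>t\<bar> * B) ^ n)"
      by (simp add: power_mult_distrib field_simps)
  qed
qed

text \<open>Continuity lets \<open>h\<close> pass under the series. With a coordinate,
  \<open>M\<close> itself or transposition for \<open>h\<close>, this yields the derivative, the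
  commutation and the symmetry of the exponential.\<close>

lemma bounded_linear_expop:
  assumes "linear M" "bounded_linear h"
  shows "h (expop t M A) = (\<Sum>n. (t ^ n / fact n) *\<^sub>R h ((M ^^ n) A))"
  unfolding expop_def
  by (subst bounded_linear.suminf[OF assms(2) summable_expop[OF assms(1)]])
    (simp add: linear_scale[OF bounded_linear.linear[OF assms(2)]])

lemma linear_funpow:
  fixes M :: "cmat \<Rightarrow> cmat"
  shows "linear M \<Longrightarrow> linear (M ^^ n)"
proof (induction n)
  case (Suc n)
  then show ?case using linear_compose[of "M ^^ n" M] by (simp add: o_def)
qed (simp add: linear_id)

lemma expop_0 [simp]: "expop 0 M A = A"
  unfolding expop_def by (subst suminf_finite[of "{0}"]) auto

lemma linear_expop:
  assumes "linear M"
  shows "linear (expop t M)"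
proof (rule linearI)
  fix A B c
  note l = linear_funpow[OF assms] and s = summable_expop[OF assms]
  show "expop t M (A + B) = expop t M A + expop t M B"
    unfolding expop_def by (subst suminf_add[OF s s]) (simp add: linear_add[OF l] algebra_simps)
  show "expop t M (c *\<^sub>R A) = c *\<^sub>R expop t M A"
    unfolding expop_def by (subst suminf_scaleR_right[OF s])
      (simp add: linear_scale[OF l] algebra_simps)
qed

lemma expop_commute:
  assumes "linear M"
  shows "expop t M (M A) = M (expop t M A)"
  by (subst bounded_linear_expop[OF assms linear_conv_bounded_linear[THEN iffD1, OF assms]])
    (simp add: expop_def funpow_swap1)

lemma expop_symmetric:
  assumes "linear M" "\<And>A. transpose A = A \<Longrightarrow> transpose (M A) = M A" "transpose A = A"
  shows "transpose (expop t M A) = expop t M A"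
proof -
  have "transpose ((M ^^ n) A) = (M ^^ n) A" for n
    by (induction n) (simp_all add: assms)
  then show ?thesis
    by (subst bounded_linear_expop[OF assms(1)
          linear_conv_bounded_linear[THEN iffD1, OF linear_transpose_cmat]])
      (simp add: expop_def)
qed

text \<open>Each coordinate is a real power series in \<open>t\<close> and is differentiated term by
  term. Differentiation shifts the index, which amounts to replacing \<open>A\<close> by
  \<open>M A\<close>; commutation then moves \<open>M\<close> outside.\<close>

lemma expop_has_vector_derivative:
  assumes "linear M"
  shows "((\<lambda>t. expop t M A) has_vector_derivative M (expop t M A)) (at t within S)"
proof -
  have "((\<lambda>t. expop t M A \<bullet> i) has_real_derivative M (expop t M A) \<bullet> i) (at t)" for i
  proof -
    define c where "c n = ((M ^^ n) A \<bullet> i) / fact n" for n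
    have bl: "bounded_linear (\<lambda>x. x \<bullet> i)" by (rule bounded_linear_inner_left)
    have e: "expop t M A \<bullet> i = (\<Sum>n. c n * t ^ n)" for t
      by (subst bounded_linear_expop[OF assms bl]) (simp add: c_def mult_ac)
    have "summable (\<lambda>n. c n * y ^ n)" for y
      using bounded_linear.summable[OF bl summable_expop[OF assms, of y A]]
      by (simp add: c_def mult_ac)
    then have "((\<lambda>t. \<Sum>n. c n * t ^ n) has_real_derivative (\<Sum>n. diffs c n * t ^ n)) (at t)"
      by (rule termdiffs_strong_converges_everywhere)
    moreover have "(\<Sum>n. diffs c n * t ^ n) = M (expop t M A) \<bullet> i"
    proof -
      have d: "diffs c n = ((M ^^ n) (M A) \<bullet> i) / fact n" for n
        by (simp add: diffs_def c_def funpow_swap1 del: of_nat_Suc)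
      have "M (expop t M A) \<bullet> i = expop t M (M A) \<bullet> i" by (simp add: expop_commute assms)
      also have "\<dots> = (\<Sum>n. diffs c n * t ^ n)"
        by (subst bounded_linear_expop[OF assms bl]) (simp add: d mult_ac)
      finally show ?thesis by simp
    qed
    ultimately show ?thesis by (simp add: e)
  qed
  then have "((\<lambda>t. expop t M A) has_derivative (\<lambda>s. s *\<^sub>R M (expop t M A))) (at t)"
    by (subst has_derivative_componentwise_within)
      (auto simp: has_field_derivative_def mult.commute[of _ "_ \<bullet> _"])
  then show ?thesis
    unfolding has_vector_derivative_def by (rule has_derivative_at_withinI)
qed

lemma continuous_on_expop:
  assumes "linear M"
  shows "continuous_on S (\<lambda>t. expop t M A)"
  using expop_has_vector_derivative[OF assms]
  by (auto simp: continuous_on_eq_continuous_within intro: has_vector_derivative_continuous)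

section \<open>A maximum principle\<close>

text \<open>A positive second derivative would make f' positive just to the right of the critical
  point, and the mean value theorem would then produce a larger value of f.\<close>

lemma second_derivative_at_max_le_0:
  fixes f f' :: "real \<Rightarrow> real"
  assumes f: "\<And>s. (f has_real_derivative f' s) (at s)"
    and f': "(f' has_real_derivative d) (at x)" and max: "\<And>s. f s \<le> f x"
  shows "d \<le> 0"
proof (rule ccontr)
  assume "\<not> d \<le> 0"
  have "f' x = 0" using DERIV_local_max[OF f, of 1 x] max by auto
  with DERIV_pos_inc_right[OF f'] \<open>\<not> d \<le> 0\<close> obtain e where
    e: "e > 0" "\<And>h. h > 0 \<Longrightarrow> h < e \<Longrightarrow> f' (x + h) > 0" by auto
  have "\<exists>z. x < z \<and> z < x + e/2 \<and> f (x + e/2) - f x = (x + e/2 - x) * f' z"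
    using e(1) f by (intro MVT2) auto
  then obtain z where z: "x < z" "z < x + e/2" "f (x + e/2) - f x = e/2 * f' z"
    by auto
  have "f' z > 0" using e(2)[of "z - x"] z e(1) by simp
  with e(1) have "e/2 * f' z > 0" by simp
  with z(3) max[of "x + e/2"] show False by linarith
qed

text \<open>No differential operator appears: the hypothesis \<open>max\<close> packages all that
  the equation contributes. Tilting \<open>p\<close> by \<open>- e * t\<close> makes the time
  derivative strictly negative at a maximum over the cylinder, so a slightly earlier time would give
  a larger value. Through \<open>per\<close>, with one representative for all times, a maximum over
  \<open>K\<close> is one over the whole space.\<close>

lemma parabolic_maximum_principle:
  fixes p p' :: "real \<Rightarrow> 'a::metric_space \<Rightarrow> real"
  assumes K: "compact K" and per: "\<And>x. \<exists>y\<in>K. \<forall>t. p t x = p t y"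
    and cont: "continuous_on ({0..T} \<times> K) (\<lambda>(t, x). p t x)"
    and deriv: "\<And>t x. ((\<lambda>t. p t x) has_real_derivative p' t x) (at t)"
    and max: "\<And>t x. (\<And>y. p t y \<le> p t x) \<Longrightarrow> p' t x \<le> 0"
    and init: "\<And>x. p 0 x \<le> c"
    and "T \<ge> 0"
  shows "p T z \<le> c"
proof (rule ccontr)
  assume neg: "\<not> p T z \<le> c"
  obtain z' where z': "z' \<in> K" "\<And>t. p t z = p t z'" using per by blast
  \<comment> \<open>Half of the supposed excess over \<open>c\<close>, divided by
    \<open>T + 1\<close> to stay well defined for T = 0. The tilt then cannot use up the excess by
    time \<open>T\<close>.\<close>
  define e where "e = (p T z - c) / (2 * (T + 1))"
  have e: "e > 0" using neg \<open>T \<ge> 0\<close> by (simp add: e_def)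
  have eT: "p T z - e * T > c"
  proof -
    have "e * T \<le> e * (T + 1)" using e by simp
    also have "\<dots> = (p T z - c) / 2" using \<open>T \<ge> 0\<close> by (simp add: e_def divide_simps)
    finally show ?thesis using neg by (simp add: field_simps)
  qed
  have "continuous_on ({0..T} \<times> K) (\<lambda>(t, x). p t x - e * t)"
    using cont by (auto simp: case_prod_unfold intro!: continuous_intros)
  moreover have "compact ({0..T} \<times> K)" using K by (intro compact_Times) auto
  moreover have "{0..T} \<times> K \<noteq> {}" using z' \<open>T \<ge> 0\<close> by auto
  ultimately obtain w where w: "w \<in> {0..T} \<times> K"
    "\<forall>y\<in>{0..T} \<times> K. (case y of (t, x) \<Rightarrow> p t x - e * t) \<le> (case w of (t, x) \<Rightarrow> p t x - e * t)"
    using continuous_attains_sup[of "{0..T} \<times> K" "\<lambda>(t, x). p t x - e * t"] by blast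
  obtain t0 x0 where w_eq: "w = (t0, x0)" by (cases w)
  have t0: "0 \<le> t0" "t0 \<le> T" and x0: "x0 \<in> K"
    and m: "\<And>t x. 0 \<le> t \<Longrightarrow> t \<le> T \<Longrightarrow> x \<in> K \<Longrightarrow> p t x - e * t \<le> p t0 x0 - e * t0"
    using w by (auto simp: w_eq)
  have "p t0 x0 - e * t0 > c" using m[of T z'] z' \<open>T \<ge> 0\<close> eT by force
  with init[of x0] have "t0 \<noteq> 0" by auto
  with t0 have "t0 > 0" by simp
  have "p t0 y \<le> p t0 x0" for y
  proof -
    obtain y' where "y' \<in> K" "\<forall>t. p t y = p t y'" using per by blast
    with m[OF t0, of y'] show ?thesis by auto
  qed
  then have "p' t0 x0 \<le> 0" by (rule max)
  then have neg': "p' t0 x0 - e < 0" using e by simp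
  have "((\<lambda>t. p t x0 - e * t) has_real_derivative p' t0 x0 - e) (at t0)"
    using deriv by (auto intro!: derivative_eq_intros)
  from DERIV_neg_dec_left[OF this neg'] obtain d where
    d: "d > 0" "\<And>h. h > 0 \<Longrightarrow> h < d \<Longrightarrow> p t0 x0 - e * t0 < p (t0 - h) x0 - e * (t0 - h)" by auto
  \<comment> \<open>The minimum with \<open>t0\<close> keeps the earlier time inside [0, T].\<close>
  define h where "h = min (d/2) t0"
  have "h > 0" "h < d" "h \<le> t0" using d(1) \<open>t0 > 0\<close> by (auto simp: h_def)
  with d(2)[of h] m[of "t0 - h" x0] t0 x0 show False by auto
qed

section \<open>Plane waves, the curl estimate and the contraction of trigonometric sums\<close>

lemma cis_eq_if_diff_int_multiple:
  assumes "a - b = 2 * pi * of_int n"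
  shows "cis a = cis b"
proof -
  have "a = b + 2 * pi * of_int n" using assms by simp
  then have "cis a = cis b * cis (2 * pi * of_int n)" by (metis cis_mult)
  then show ?thesis by simp
qed

text \<open>Reduction of \<open>x\<close> modulo the periods. A single representative serves all
  frequencies at once, hence a whole trigonometric sum at all times.\<close>

lemma wave_periodic:
  assumes l: "\<And>j. l $ j > 0"
  shows "\<exists>y\<in>Omega l. \<forall>k. cis (wavevec l k \<bullet> x) = cis (wavevec l k \<bullet> y)"
proof -
  define y where "y = (\<chi> j. l $ j * frac (x $ j / l $ j))"
  have "y \<in> Omega l"
    using l by (auto simp: y_def Omega_def mem_box_cart less_imp_le frac_lt_1[THEN less_imp_le])
  moreover have "cis (wavevec l k \<bullet> x) = cis (wavevec l k \<bullet> y)" for k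
  proof (rule cis_eq_if_diff_int_multiple)
    have "wavevec l k $ j * x $ j - wavevec l k $ j * y $ j
        = 2 * pi * of_int (k $ j * \<lfloor>x $ j / l $ j\<rfloor>)" for j
      using l[of j] by (simp add: wavevec_def y_def frac_def field_simps)
    then show "wavevec l k \<bullet> x - wavevec l k \<bullet> y
        = 2 * pi * of_int (\<Sum>j\<in>UNIV. k $ j * \<lfloor>x $ j / l $ j\<rfloor>)"
      by (simp add: inner_vec_def sum_subtractf[symmetric] sum_distrib_left)
  qed
  ultimately show ?thesis by blast
qed

text \<open>The curl in physical space, with \<open>D k\<close> standing for the k-th partial
  derivative of a matrix field; \<open>curl_sym\<close> is its Fourier counterpart for a single
  mode.\<close>

definition curl_of :: "(3 \<Rightarrow> cmat) \<Rightarrow> cmat" where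
  "curl_of D = (\<chi> i j. \<Sum>k\<in>UNIV. \<Sum>m\<in>UNIV. complex_of_real (levi i k m) * D k $ m $ j)"

lemma norm_diff_sq_le: "(norm (x - y))\<^sup>2 \<le> 2 * (norm x)\<^sup>2 + 2 * (norm (y::complex))\<^sup>2"
proof -
  have "(norm (x - y))\<^sup>2 \<le> (norm x + norm y)\<^sup>2"
    by (intro power_mono norm_triangle_ineq4) auto
  also have "\<dots> \<le> 2 * (norm x)\<^sup>2 + 2 * (norm y)\<^sup>2"
    using zero_le_power2[of "norm x - norm y"] by (simp add: power2_eq_square algebra_simps)
  finally show ?thesis .
qed

text \<open>Each entry of the curl is a difference of two gradient entries, and every
  \<open>D k $ m $ j\<close> with k and m distinct occurs exactly once. The factor 2 turns the L4^2
  / (4 L1) of Young's inequality into the threshold L4^2 / (2 L1).\<close>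

lemma norm_curl_of_sq_le: "(norm (curl_of D))\<^sup>2 \<le> 2 * (\<Sum>k\<in>UNIV. (norm (D k))\<^sup>2)"
proof -
  have c: "curl_of D $ 1 $ j = D 2 $ 3 $ j - D 3 $ 2 $ j"
    "curl_of D $ 2 $ j = D 3 $ 1 $ j - D 1 $ 3 $ j"
    "curl_of D $ 3 $ j = D 1 $ 2 $ j - D 2 $ 1 $ j" for j
    by (simp_all add: curl_of_def sum_3 levi_def)
  have "(norm (curl_of D))\<^sup>2 = (\<Sum>j\<in>UNIV. \<Sum>i\<in>UNIV. (norm (curl_of D $ i $ j))\<^sup>2)"
    unfolding norm_sq_cmat by (rule sum.swap)
  also have "\<dots> \<le> (\<Sum>j\<in>UNIV. 2 * (\<Sum>k\<in>UNIV. \<Sum>i\<in>UNIV. (norm (D k $ i $ j))\<^sup>2))"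
  proof (rule sum_mono)
    fix j :: 3
    have "(\<Sum>i\<in>UNIV. (norm (curl_of D $ i $ j))\<^sup>2)
        \<le> (2 * (norm (D 2 $ 3 $ j))\<^sup>2 + 2 * (norm (D 3 $ 2 $ j))\<^sup>2)
        + (2 * (norm (D 3 $ 1 $ j))\<^sup>2 + 2 * (norm (D 1 $ 3 $ j))\<^sup>2)
        + (2 * (norm (D 1 $ 2 $ j))\<^sup>2 + 2 * (norm (D 2 $ 1 $ j))\<^sup>2)"
      unfolding sum_3 c by (intro add_mono norm_diff_sq_le)
    also have "\<dots> \<le> 2 * (\<Sum>k\<in>UNIV. \<Sum>i\<in>UNIV. (norm (D k $ i $ j))\<^sup>2)"
      unfolding sum_3 by (simp add: algebra_simps)
    finally show "(\<Sum>i\<in>UNIV. (norm (curl_of D $ i $ j))\<^sup>2)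
      \<le> 2 * (\<Sum>k\<in>UNIV. \<Sum>i\<in>UNIV. (norm (D k $ i $ j))\<^sup>2)" .
  qed
  also have "\<dots> = 2 * (\<Sum>k\<in>UNIV. (norm (D k))\<^sup>2)"
    unfolding norm_sq_cmat sum_3 by simp
  finally show ?thesis .
qed

text \<open>With \<open>D j\<close> and \<open>H j\<close> the first and second derivatives of u in
  direction j at a maximum of |u|^2, the hypothesis \<open>max\<close> is half of the second
  derivative test; summed over j it bounds the inner product of u with its Laplacian by - |grad
  u|^2. Symmetry of \<open>u\<close> makes both curl terms contribute equally, so L4 / 2 becomes
  L4.\<close>

lemma operator_inner_le_at_max:
  fixes u :: cmat
  assumes "L1 > 0" "\<kappa>2 \<ge> L4\<^sup>2 / (2 * L1)" "transpose u = u"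
    and max: "\<And>j. D j \<bullet> D j + u \<bullet> H j \<le> 0"
  shows "u \<bullet> (L1 *\<^sub>R (\<Sum>j\<in>UNIV. H j) - (L4 / 2) *\<^sub>R (curl_of D + transpose (curl_of D))
          - \<kappa>1 *\<^sub>R u - \<kappa>2 *\<^sub>R u) \<le> - \<kappa>1 * (u \<bullet> u)"
proof -
  define d where "d = (\<Sum>j\<in>UNIV. (norm (D j))\<^sup>2)"
  define X where "X = u \<bullet> curl_of D"
  have "(\<Sum>j\<in>UNIV. D j \<bullet> D j + u \<bullet> H j) \<le> 0" using max by (intro sum_nonpos) auto
  then have h: "(\<Sum>j\<in>UNIV. u \<bullet> H j) \<le> - d"
    by (simp add: d_def sum.distrib power2_norm_eq_inner)
  have t: "u \<bullet> transpose (curl_of D) = X"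
    using assms(3) by (simp add: inner_transpose_cmat X_def)
  have "- L4 * X \<le> L1 * d + \<kappa>2 * (u \<bullet> u)"
  proof -
    have X: "\<bar>X\<bar> \<le> norm u * norm (curl_of D)" unfolding X_def by (rule Cauchy_Schwarz_ineq2)
    have "- L4 * X \<le> \<bar>L4\<bar> * \<bar>X\<bar>" by (metis abs_ge_self abs_minus_cancel abs_mult)
    also have "\<dots> \<le> \<bar>L4\<bar> * (norm u * norm (curl_of D))" using X by (intro mult_left_mono) auto
    \<comment> \<open>Young's inequality, weighted so that the curl estimate turns the first term
      into exactly L1 |grad u|^2.\<close>
    also have "\<dots> \<le> L1 / 2 * (norm (curl_of D))\<^sup>2 + L4\<^sup>2 / (2 * L1) * (norm u)\<^sup>2"
    proof -
      have "0 \<le> (L1 * norm (curl_of D) - \<bar>L4\<bar> * norm u)\<^sup>2 / (2 * L1)" using assms(1) by simp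
      also have "\<dots> = L1 / 2 * (norm (curl_of D))\<^sup>2 + L4\<^sup>2 / (2 * L1) * (norm u)\<^sup>2
          - \<bar>L4\<bar> * (norm u * norm (curl_of D))"
        using assms(1) by (simp add: power2_eq_square field_simps)
      finally show ?thesis by simp
    qed
    also have "\<dots> \<le> L1 / 2 * (2 * d) + \<kappa>2 * (norm u)\<^sup>2"
      using norm_curl_of_sq_le[of D] assms(1,2) unfolding d_def
      by (intro add_mono mult_left_mono mult_right_mono) auto
    finally show ?thesis by (simp add: power2_norm_eq_inner)
  qed
  moreover have "L1 * (\<Sum>j\<in>UNIV. u \<bullet> H j) \<le> L1 * - d" using h assms(1) by (intro mult_left_mono) auto
  ultimately show ?thesis
    by (simp add: inner_diff_right inner_add_right inner_sum_right t X_def[symmetric])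
qed

text \<open>The multipliers i \<xi>_j and - \<xi>_j^2 are the first and second partial derivatives
  of a plane wave, so this identifies the mode-by-mode action of the symbol with the differential
  operator applied to the whole sum. A single mode is an entrywise computation, and additivity does
  the rest.\<close>

lemma cscale_sum_Lsym:
  assumes "finite I"
  shows "(\<Sum>k\<in>I. cscale (e k) (Lsym L1 L4 \<kappa>1 \<kappa>2 (\<xi> k) (U k))) =
    L1 *\<^sub>R (\<Sum>j\<in>UNIV. \<Sum>k\<in>I. cscale (e k) (cscale (- (of_real (\<xi> k $ j))\<^sup>2) (U k)))
    - (L4 / 2) *\<^sub>R (curl_of (\<lambda>j. \<Sum>k\<in>I. cscale (e k) (cscale (\<i> * of_real (\<xi> k $ j)) (U k)))
       + transpose (curl_of (\<lambda>j. \<Sum>k\<in>I. cscale (e k) (cscale (\<i> * of_real (\<xi> k $ j)) (U k)))))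
    - \<kappa>1 *\<^sub>R (\<Sum>k\<in>I. cscale (e k) (U k)) - \<kappa>2 *\<^sub>R (\<Sum>k\<in>I. cscale (e k) (U k))"
  using assms
proof (induction I rule: finite_induct)
  case empty
  show ?case by (simp add: vec_eq_iff curl_of_def transpose_def)
next
  case (insert a I)
  have n: "(norm (\<xi> a))\<^sup>2 = (\<Sum>j\<in>UNIV. (\<xi> a $ j)\<^sup>2)"
    by (simp add: power2_norm_eq_inner inner_vec_def) (simp add: power2_eq_square)
  have "cscale (e a) (Lsym L1 L4 \<kappa>1 \<kappa>2 (\<xi> a) (U a)) =
    L1 *\<^sub>R (\<Sum>j\<in>UNIV. cscale (e a) (cscale (- (of_real (\<xi> a $ j))\<^sup>2) (U a)))
    - (L4 / 2) *\<^sub>R (curl_of (\<lambda>j. cscale (e a) (cscale (\<i> * of_real (\<xi> a $ j)) (U a)))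
       + transpose (curl_of (\<lambda>j. cscale (e a) (cscale (\<i> * of_real (\<xi> a $ j)) (U a)))))
    - \<kappa>1 *\<^sub>R cscale (e a) (U a) - \<kappa>2 *\<^sub>R cscale (e a) (U a)"
    by (simp add: vec_eq_iff Lsym_def n curl_of_def curl_sym_def transpose_def sum_3
        scaleR_conv_of_real[where 'a = complex] algebra_simps)
  moreover have "curl_of (\<lambda>j. P j + R j) = curl_of P + curl_of R" for P R
    by (simp add: vec_eq_iff curl_of_def algebra_simps sum.distrib)
  ultimately show ?case
    by (simp add: insert sum.distrib linear_add[OF linear_transpose_cmat] scaleR_add_right)
qed

text \<open>The index set is arbitrary so that frequencies may repeat, as they do in the double sum
  of a Fejer mean. The weight exp (2 \<kappa>1 t) in \<open>p\<close> cancels exactly the decay due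
  to the damping \<kappa>1, so that the time derivative at a spatial maximum is merely
  nonpositive.\<close>

lemma trig_sum_contraction:
  fixes k :: "'k \<Rightarrow> int^3" and A :: "'k \<Rightarrow> cmat"
  assumes l: "\<And>j. l $ j > 0" and fin: "finite I"
    and L: "L1 > 0" "\<kappa>2 \<ge> L4\<^sup>2 / (2 * L1)"
    and sym: "\<And>i. i \<in> I \<Longrightarrow> transpose (A i) = A i"
    and bnd: "\<And>x. norm (\<Sum>i\<in>I. cscale (cis (wavevec l (k i) \<bullet> x)) (A i)) \<le> c"
    and "t \<ge> 0"
  shows "norm (\<Sum>i\<in>I. cscale (cis (wavevec l (k i) \<bullet> x))
      (expop t (Lsym L1 L4 \<kappa>1 \<kappa>2 (wavevec l (k i))) (A i))) \<le> exp (- \<kappa>1 * t) * c"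
proof -
  define \<xi> where "\<xi> i = wavevec l (k i)" for i
  define M where "M i = Lsym L1 L4 \<kappa>1 \<kappa>2 (\<xi> i)" for i
  have linM: "linear (M i)" for i unfolding M_def by (rule linear_Lsym)
  define U where "U t i = expop t (M i) (A i)" for t i
  define u where "u t x = (\<Sum>i\<in>I. cscale (cis (\<xi> i \<bullet> x)) (U t i))" for t x
  define u' where "u' t x = (\<Sum>i\<in>I. cscale (cis (\<xi> i \<bullet> x)) (M i (U t i)))" for t x
  define p where "p t x = exp (2 * \<kappa>1 * t) * (u t x \<bullet> u t x)" for t x
  define p' where "p' t x = exp (2 * \<kappa>1 * t) * (2 * (u t x \<bullet> u' t x) + 2 * \<kappa>1 * (u t x \<bullet> u t x))" for t x
  have c0: "c \<ge> 0" using bnd[of 0] norm_ge_zero order_trans by blast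
  have "((\<lambda>t. U t i) has_vector_derivative M i (U t i)) (at t)" for t i
    unfolding U_def by (rule expop_has_vector_derivative[OF linM])
  then have du: "((\<lambda>t. u t x) has_vector_derivative u' t x) (at t)" for t x
    unfolding u_def u'_def
    by (intro has_vector_derivative_sum
        bounded_linear.has_vector_derivative[OF cscale.bounded_linear_right])
  have "p t x \<le> c\<^sup>2"
  proof (rule parabolic_maximum_principle[where K = "Omega l" and p = p and p' = p'])
    show "compact (Omega l)" by (simp add: Omega_def)
    show "\<exists>y\<in>Omega l. \<forall>t. p t x = p t y" for x
    proof -
      obtain y where "y \<in> Omega l" "\<And>k. cis (wavevec l k \<bullet> x) = cis (wavevec l k \<bullet> y)"
        using wave_periodic[OF l, of x] by blast
      then show ?thesis unfolding p_def u_def \<xi>_def by (intro bexI[of _ y]) auto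
    qed
    show "continuous_on ({0..t} \<times> Omega l) (\<lambda>(t, x). p t x)"
    proof -
      have "continuous_on S (\<lambda>z. U (fst z) i)" for i and S :: "(real \<times> (real^3)) set"
        unfolding U_def
        by (rule continuous_on_compose2[OF continuous_on_expop[OF linM, of UNIV]])
          (auto intro!: continuous_intros)
      then show ?thesis
        unfolding p_def u_def case_prod_unfold cis_conv_exp
        by (intro continuous_intros cscale.continuous_on)
    qed
    show "((\<lambda>t. p t x) has_real_derivative p' t x) (at t)" for t x
    proof -
      have "((\<lambda>t. u t x \<bullet> u t x) has_real_derivative u t x \<bullet> u' t x + u' t x \<bullet> u t x) (at t)"
        using bounded_bilinear.has_vector_derivative[OF bounded_bilinear_inner du du]
        by (simp add: has_real_derivative_iff_has_vector_derivative)
      then show ?thesis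
        unfolding p_def p'_def
        by (auto intro!: derivative_eq_intros simp: inner_commute algebra_simps)
    qed
    show "p 0 x \<le> c\<^sup>2" for x
      using bnd[of x] unfolding p_def u_def U_def \<xi>_def
      by (simp add: power2_norm_eq_inner[symmetric] power_mono)
    show "p' t x \<le> 0" if max: "\<And>y. p t y \<le> p t x" for t x
    proof -
      define D where "D j = (\<Sum>i\<in>I. cscale (cis (\<xi> i \<bullet> x)) (cscale (\<i> * of_real (\<xi> i $ j)) (U t i)))" for j
      define H where "H j = (\<Sum>i\<in>I. cscale (cis (\<xi> i \<bullet> x)) (cscale (- (of_real (\<xi> i $ j))\<^sup>2) (U t i)))" for j
      have u': "u' t x = L1 *\<^sub>R (\<Sum>j\<in>UNIV. H j) - (L4 / 2) *\<^sub>R (curl_of D + transpose (curl_of D))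
          - \<kappa>1 *\<^sub>R u t x - \<kappa>2 *\<^sub>R u t x"
        unfolding u'_def M_def H_def D_def u_def by (rule cscale_sum_Lsym[OF fin])
      have "transpose (U t i) = U t i" if "i \<in> I" for i
        unfolding U_def
        by (rule expop_symmetric[OF linM]) (simp_all add: M_def Lsym_symmetric sym that)
      then have symu: "transpose (u t x) = u t x"
        unfolding u_def by (simp add: linear_sum[OF linear_transpose_cmat] transpose_cscale)
      have "D j \<bullet> D j + u t x \<bullet> H j \<le> 0" for j
      proof -
        \<comment> \<open>On the coordinate line through the maximum point, |v|^2 is maximal at s =
          0, and its second derivative there is twice
          \<open>D j \<bullet> D j + u t x \<bullet> H j\<close>.\<close>
        define v where "v s = u t (x + s *\<^sub>R axis j 1)" for s
        define v' where "v' s = (\<Sum>i\<in>I. cscale (cis (\<xi> i \<bullet> (x + s *\<^sub>R axis j 1)) * (\<i> * of_real (\<xi> i $ j))) (U t i))" for s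
        have dcis: "((\<lambda>s. cis (\<xi> i \<bullet> (x + s *\<^sub>R axis j 1))) has_vector_derivative
           cis (\<xi> i \<bullet> (x + s *\<^sub>R axis j 1)) * (\<i> * of_real (\<xi> i $ j))) (at s)" for i s
        proof -
          have "((\<lambda>s. \<xi> i \<bullet> (x + s *\<^sub>R axis j 1)) has_vector_derivative \<xi> i $ j) (at s)"
            by (auto intro!: derivative_eq_intros simp: inner_add_right inner_axis
                has_real_derivative_iff_has_vector_derivative[symmetric])
          moreover have "(cis has_vector_derivative \<i> * cis y) (at y)" for y
            using has_derivative_cis[OF has_derivative_ident, of y UNIV]
            by (simp add: has_vector_derivative_def scaleR_conv_of_real)
          ultimately have "(cis \<circ> (\<lambda>s. \<xi> i \<bullet> (x + s *\<^sub>R axis j 1)) has_vector_derivative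
              (\<xi> i $ j) *\<^sub>R (\<i> * cis (\<xi> i \<bullet> (x + s *\<^sub>R axis j 1)))) (at s)"
            by (rule vector_diff_chain_at)
          then show ?thesis
            by (simp add: o_def scaleR_conv_of_real[where 'a = complex] mult_ac)
        qed
        have dv: "(v has_vector_derivative v' s) (at s)" for s
          unfolding v_def v'_def u_def
          by (intro has_vector_derivative_sum
              bounded_linear.has_vector_derivative[OF cscale.bounded_linear_left] dcis)
        have "(v' has_vector_derivative (\<Sum>i\<in>I. cscale (cis (\<xi> i \<bullet> (x + 0 *\<^sub>R axis j 1))
            * (\<i> * of_real (\<xi> i $ j)) * (\<i> * of_real (\<xi> i $ j))) (U t i))) (at 0)"
          unfolding v'_def
          by (intro has_vector_derivative_sum
              bounded_linear.has_vector_derivative[OF cscale.bounded_linear_left]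
              bounded_linear.has_vector_derivative[OF bounded_linear_mult_left] dcis)
        also have "(\<Sum>i\<in>I. cscale (cis (\<xi> i \<bullet> (x + 0 *\<^sub>R axis j 1))
            * (\<i> * of_real (\<xi> i $ j)) * (\<i> * of_real (\<xi> i $ j))) (U t i)) = H j"
          unfolding H_def by (intro sum.cong) (simp_all add: vec_eq_iff power2_eq_square mult_ac)
        finally have dv': "(v' has_vector_derivative H j) (at 0)" .
        have v0: "v 0 = u t x" "v' 0 = D j"
          unfolding v_def v'_def D_def by (simp_all add: vec_eq_iff mult_ac)
        have "v' 0 \<bullet> v' 0 + v 0 \<bullet> H j + (v' 0 \<bullet> v' 0 + v 0 \<bullet> H j) \<le> 0"
        proof (rule second_derivative_at_max_le_0[where f = "\<lambda>s. v s \<bullet> v s"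
              and f' = "\<lambda>s. v s \<bullet> v' s + v s \<bullet> v' s" and x = 0])
          show "((\<lambda>s. v s \<bullet> v s) has_real_derivative v s \<bullet> v' s + v s \<bullet> v' s) (at s)" for s
            using bounded_bilinear.has_vector_derivative[OF bounded_bilinear_inner dv dv]
            by (simp add: has_real_derivative_iff_has_vector_derivative inner_commute)
          have "((\<lambda>s. v s \<bullet> v' s) has_vector_derivative (v' 0 \<bullet> v' 0 + v 0 \<bullet> H j)) (at 0)"
            using bounded_bilinear.has_vector_derivative[OF bounded_bilinear_inner dv dv']
            by (simp add: add.commute)
          then show "((\<lambda>s. v s \<bullet> v' s + v s \<bullet> v' s) has_real_derivative
              v' 0 \<bullet> v' 0 + v 0 \<bullet> H j + (v' 0 \<bullet> v' 0 + v 0 \<bullet> H j)) (at 0)"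
            unfolding has_real_derivative_iff_has_vector_derivative
            by (intro has_vector_derivative_add)
          show "v s \<bullet> v s \<le> v 0 \<bullet> v 0" for s
            using max[of "x + s *\<^sub>R axis j 1"] by (simp add: v_def p_def)
        qed
        then show ?thesis by (simp add: v0)
      qed
      then have "u t x \<bullet> u' t x \<le> - \<kappa>1 * (u t x \<bullet> u t x)"
        unfolding u' by (rule operator_inner_le_at_max[OF L symu])
      then show ?thesis unfolding p'_def by (intro mult_nonneg_nonpos) auto
    qed
    show "t \<ge> 0" by fact
  qed
  then have "(exp (\<kappa>1 * t) * norm (u t x))\<^sup>2 \<le> c\<^sup>2"
    by (simp add: p_def power_mult_distrib power2_norm_eq_inner exp_double mult.assoc)
  then have "exp (\<kappa>1 * t) * norm (u t x) \<le> c" using c0 by (rule power2_le_imp_le)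
  then have "norm (u t x) \<le> exp (- \<kappa>1 * t) * c"
    by (simp add: exp_minus field_simps)
  then show ?thesis unfolding u_def U_def M_def \<xi>_def .
qed

section \<open>Integration over the periodic box\<close>

abbreviation boxm :: "real^3 \<Rightarrow> (real^3) measure" where
  "boxm l \<equiv> restrict_space lborel (Omega l)"

definition vol :: "real^3 \<Rightarrow> real" where
  "vol l = (\<Prod>j\<in>UNIV. l $ j)"

lemma Omega_borel [measurable, simp]: "Omega l \<in> sets borel"
  by (simp add: Omega_def)

lemma space_boxm [simp]: "space (boxm l) = Omega l"
  by (simp add: space_restrict_space)

lemma set_integrable_boxm: "set_integrable lborel (Omega l) f \<longleftrightarrow> integrable (boxm l) f"
  for f :: "real^3 \<Rightarrow> 'b::{banach, second_countable_topology}"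
  by (simp add: set_integrable_def integrable_restrict_space)

lemma set_integral_boxm: "(LINT x : Omega l | lborel. f x) = integral\<^sup>L (boxm l) f"
  for f :: "real^3 \<Rightarrow> 'b::{banach, second_countable_topology}"
  by (simp add: set_lebesgue_integral_def integral_restrict_space)

lemma AE_boxm: "(AE x in boxm l. P x) \<longleftrightarrow> (AE x in lborel. x \<in> Omega l \<longrightarrow> P x)"
  by (simp add: AE_restrict_space_iff)

lemma finite_measure_boxm: "finite_measure (boxm l)"
  by (rule finite_measureI)
    (use emeasure_lborel_cbox_finite[of 0 l] in
      \<open>auto simp: emeasure_restrict_space Omega_def less_top[symmetric]\<close>)

lemma borel_measurable_boxm: "f \<in> borel_measurable borel \<Longrightarrow> f \<in> borel_measurable (boxm l)"
  by (rule measurable_restrict_space1) simp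

lemma integrable_scaleR_bounded:
  fixes f :: "'a \<Rightarrow> 'b::{banach, second_countable_topology}" and h :: "'a \<Rightarrow> real"
  assumes "integrable M f" "h \<in> borel_measurable M" "\<And>x. x \<in> space M \<Longrightarrow> \<bar>h x\<bar> \<le> B"
  shows "integrable M (\<lambda>x. h x *\<^sub>R f x)"
proof (rule Bochner_Integration.integrable_bound)
  show "integrable M (\<lambda>x. B * norm (f x))" using assms(1) by simp
  have "f \<in> borel_measurable M" using assms(1) by simp
  then show "(\<lambda>x. h x *\<^sub>R f x) \<in> borel_measurable M" using assms(2) by measurable
  show "AE x in M. norm (h x *\<^sub>R f x) \<le> norm (B * norm (f x))"
  proof (rule AE_I2)
    fix x assume "x \<in> space M"
    then have "\<bar>h x\<bar> \<le> \<bar>B\<bar>" using assms(3)[of x] by linarith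
    then show "norm (h x *\<^sub>R f x) \<le> norm (B * norm (f x))" by (simp add: abs_mult mult_right_mono)
  qed
qed

lemma integrable_scaleR_bounded_right:
  fixes f :: "'a \<Rightarrow> real" and h :: "'a \<Rightarrow> 'b::{banach, second_countable_topology}"
  assumes "integrable M f" "h \<in> borel_measurable M" "\<And>x. x \<in> space M \<Longrightarrow> norm (h x) \<le> B"
  shows "integrable M (\<lambda>x. f x *\<^sub>R h x)"
proof (rule Bochner_Integration.integrable_bound)
  show "integrable M (\<lambda>x. B * norm (f x))" using assms(1) by simp
  have "f \<in> borel_measurable M" using assms(1) by simp
  then show "(\<lambda>x. f x *\<^sub>R h x) \<in> borel_measurable M" using assms(2) by measurable
  show "AE x in M. norm (f x *\<^sub>R h x) \<le> norm (B * norm (f x))"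
  proof (rule AE_I2)
    fix x assume "x \<in> space M"
    then have "norm (h x) \<le> \<bar>B\<bar>" using assms(3)[of x] by linarith
    then show "norm (f x *\<^sub>R h x) \<le> norm (B * norm (f x))"
      by (simp add: abs_mult mult_left_mono mult.commute[of "\<bar>B\<bar>"])
  qed
qed

lemma integrable_boxm_bounded:
  fixes f :: "real^3 \<Rightarrow> 'b::{banach, second_countable_topology}"
  assumes "f \<in> borel_measurable borel" "\<And>x. x \<in> Omega l \<Longrightarrow> norm (f x) \<le> B"
  shows "integrable (boxm l) f"
proof -
  interpret finite_measure "boxm l" by (rule finite_measure_boxm)
  show ?thesis
    using assms by (intro integrable_const_bound[of _ B] borel_measurable_boxm AE_I2) auto
qed

lemma integrable_boxm_continuous:
  fixes f :: "real^3 \<Rightarrow> 'b::{banach, second_countable_topology}"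
  assumes "continuous_on UNIV f"
  shows "integrable (boxm l) f"
proof -
  have "compact (f ` Omega l)"
    unfolding Omega_def by (intro compact_continuous_image continuous_on_subset[OF assms]) auto
  then obtain B where "\<And>x. x \<in> Omega l \<Longrightarrow> norm (f x) \<le> B"
    using compact_imp_bounded bounded_iff by (metis imageI)
  then show ?thesis
    by (intro integrable_boxm_bounded borel_measurable_continuous_onI assms)
qed

text \<open>Lebesgue measure on a Euclidean space is the image of a product of one-dimensional
  Lebesgue measures under the coordinate map, which reduces the claim to Fubini for finite
  products.\<close>

lemma integral_lborel_prod:
  fixes f :: "'a::euclidean_space \<Rightarrow> real \<Rightarrow> complex"
  assumes "\<And>b. b \<in> Basis \<Longrightarrow> integrable lborel (f b)"
  shows "(\<integral>x. (\<Prod>b\<in>Basis. f b (x \<bullet> b)) \<partial>lborel) = (\<Prod>b\<in>Basis. integral\<^sup>L lborel (f b))"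
proof -
  interpret product_sigma_finite "\<lambda>_::'a. lborel :: real measure"
    by standard
  have m: "f b \<in> borel_measurable borel" if "b \<in> Basis" for b
    using borel_measurable_integrable[OF assms[OF that]] by simp
  have "(\<lambda>x. \<Prod>b\<in>Basis. f b (x \<bullet> b)) \<in> borel_measurable (borel :: 'a measure)"
    by (intro borel_measurable_prod measurable_compose[OF _ m]) auto
  then have "(\<integral>x. (\<Prod>b\<in>Basis. f b (x \<bullet> b)) \<partial>lborel)
      = (\<integral>x. (\<Prod>b\<in>Basis. f b ((\<Sum>b\<in>Basis. x b *\<^sub>R b) \<bullet> b)) \<partial>(\<Pi>\<^sub>M b\<in>Basis. lborel))"
    unfolding lborel_def[where 'a = 'a] lborel_eq_real[symmetric]
    by (subst integral_distr) auto
  also have "\<dots> = (\<integral>x. (\<Prod>b\<in>Basis. f b (x b)) \<partial>(\<Pi>\<^sub>M b\<in>Basis. lborel))"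
    by (intro Bochner_Integration.integral_cong prod.cong) auto
  also have "\<dots> = (\<Prod>b\<in>Basis. integral\<^sup>L lborel (f b))"
    by (rule product_integral_prod) (auto intro: assms)
  finally show ?thesis .
qed

lemma cis_integral:
  assumes "L > 0"
  shows "(\<integral>y. indicator {0..L} y *\<^sub>R cis (2 * pi * of_int m / L * y) \<partial>lborel)
    = (if m = 0 then of_real L else 0)"
proof (cases "m = 0")
  case False
  define c where "c = 2 * pi * of_int m / L"
  have c: "c \<noteq> 0" using False assms by (simp add: c_def)
  have "(\<integral>y. indicator {0..L} y *\<^sub>R cis (c * y) \<partial>lborel)
      = cis (c * L) / (\<i> * of_real c) - cis (c * 0) / (\<i> * of_real c)"
  proof (rule integral_FTC_atLeastAtMost)
    show "0 \<le> L" using assms by simp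
    show "continuous_on {0..L} (\<lambda>y. cis (c * y))"
      unfolding cis_conv_exp by (intro continuous_intros)
    fix y
    have "((\<lambda>z. exp (\<i> * of_real c * z) / (\<i> * of_real c)) has_field_derivative
        exp (\<i> * of_real c * of_real y)) (at (of_real y))"
      using c by (auto intro!: derivative_eq_intros)
    from has_vector_derivative_real_field[OF this, of "{0..L}"]
    show "((\<lambda>y. cis (c * y) / (\<i> * of_real c)) has_vector_derivative cis (c * y)) (at y within {0..L})"
      by (simp add: cis_conv_exp mult.assoc)
  qed
  also have "c * L = 2 * pi * of_int m" using assms by (simp add: c_def)
  finally show ?thesis using False by (simp add: c_def)
qed (use assms in \<open>simp add: scaleR_conv_of_real\<close>)

text \<open>Plane wave and indicator of the box both factor over the coordinates, and a coordinate
  with nonzero frequency is integrated over full periods.\<close>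

lemma wave_integral:
  assumes l: "\<And>j. l $ j > 0"
  shows "(\<integral>x. cis (wavevec l k \<bullet> x) \<partial>boxm l) = (if k = 0 then of_real (vol l) else 0)"
proof -
  define f where "f b y = indicator {0..l \<bullet> b} y *\<^sub>R cis (wavevec l k \<bullet> b * y)" for b y
  have ax: "\<exists>j. b = axis j 1" if "b \<in> Basis" for b :: "real^3"
    using that by (auto simp: Basis_vec_def)
  have int: "integral\<^sup>L lborel (f (axis j 1)) = (if k $ j = 0 then of_real (l $ j) else 0)" for j
    using cis_integral[OF l, of j "k $ j"]
    by (simp add: f_def[abs_def] inner_axis wavevec_def)
  have "(\<integral>x. cis (wavevec l k \<bullet> x) \<partial>boxm l)
      = (\<integral>x. indicator (Omega l) x *\<^sub>R cis (wavevec l k \<bullet> x) \<partial>lborel)"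
    by (simp add: integral_restrict_space)
  also have "\<dots> = (\<integral>x. (\<Prod>b\<in>Basis. f b (x \<bullet> b)) \<partial>lborel)"
  proof (rule Bochner_Integration.integral_cong)
    fix x
    have "(\<Prod>b\<in>Basis. f b (x \<bullet> b))
       = of_real (\<Prod>b\<in>Basis. indicator {0..l \<bullet> b} (x \<bullet> b)) * (\<Prod>b\<in>Basis. cis (wavevec l k \<bullet> b * (x \<bullet> b)))"
      by (simp add: f_def scaleR_conv_of_real prod.distrib)
    also have "(\<Prod>b\<in>Basis. indicator {0..l \<bullet> b} (x \<bullet> b)) = (indicator (Omega l) x :: real)"
      by (auto simp: indicator_def Omega_def mem_box)
    also have "(\<Prod>b\<in>Basis. cis (wavevec l k \<bullet> b * (x \<bullet> b))) = cis (\<Sum>b\<in>Basis. wavevec l k \<bullet> b * (x \<bullet> b))"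
      by (simp add: cis_conv_exp exp_sum sum_distrib_left)
    also have "(\<Sum>b\<in>Basis. wavevec l k \<bullet> b * (x \<bullet> b)) = wavevec l k \<bullet> x"
      by (rule euclidean_inner[symmetric])
    finally show "indicator (Omega l) x *\<^sub>R cis (wavevec l k \<bullet> x) = (\<Prod>b\<in>Basis. f b (x \<bullet> b))"
      by (simp add: scaleR_conv_of_real)
  qed simp
  also have "\<dots> = (\<Prod>b\<in>Basis. integral\<^sup>L lborel (f b))"
  proof (rule integral_lborel_prod)
    fix b :: "real^3" assume "b \<in> Basis"
    have "continuous_on {0..l \<bullet> b} (\<lambda>y. cis (wavevec l k \<bullet> b * y))"
      unfolding cis_conv_exp by (intro continuous_intros)
    from borel_integrable_atLeastAtMost'[OF this]
    show "integrable lborel (f b)"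
      by (simp add: set_integrable_def f_def[abs_def])
  qed
  also have "\<dots> = (\<Prod>j\<in>UNIV. integral\<^sup>L lborel (f (axis j 1)))"
  proof -
    have B: "(Basis :: (real^3) set) = (\<lambda>j. axis j 1) ` UNIV" by (auto simp: Basis_vec_def)
    have "inj (\<lambda>j. axis j 1 :: real^3)" by (auto simp: inj_def axis_eq_axis)
    then show ?thesis unfolding B by (subst prod.reindex) (auto simp: o_def)
  qed
  also have "\<dots> = (if k = 0 then of_real (vol l) else 0)"
    by (auto simp: int vol_def vec_eq_iff)
  finally show ?thesis .
qed

section \<open>The Fejer kernel on the box\<close>

text \<open>The cube starts at 0 instead of being centred: the kernel depends only on differences of
  frequencies.\<close>

definition freqs :: "nat \<Rightarrow> (int^3) set" where
  "freqs n = {k. \<forall>j. k $ j \<in> {0..int n}}"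

text \<open>The product of the one-dimensional Fejer kernels of the three coordinates. The squared
  modulus makes positivity immediate, and expanding it gives the Fourier coefficients.\<close>

definition fejer :: "real^3 \<Rightarrow> nat \<Rightarrow> real^3 \<Rightarrow> real" where
  "fejer l n z = (cmod (\<Sum>k\<in>freqs n. cis (wavevec l k \<bullet> z)))\<^sup>2 / real (card (freqs n))"

text \<open>It acts on a family of coefficients because that is how the scheme is given. The sum
  over pairs is the expanded square of the kernel; each frequency is counted once per pair with that
  difference, which produces the Fejer weights.\<close>

definition fejer_mean :: "real^3 \<Rightarrow> nat \<Rightarrow> (int^3 \<Rightarrow> cmat) \<Rightarrow> real^3 \<Rightarrow> cmat" where
  "fejer_mean l n A x = (\<Sum>i\<in>freqs n \<times> freqs n.
     cscale (cis (wavevec l (fst i - snd i) \<bullet> x)) ((1 / real (card (freqs n))) *\<^sub>R A (fst i - snd i)))"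

lemma bij_betw_vec_box:
  "bij_betw vec_lambda (PiE UNIV S) {k :: 'a^'n. \<forall>j. k $ j \<in> S j}"
  by (rule bij_betw_byWitness[where f' = vec_nth]) (auto simp: PiE_iff)

lemma card_vec_box: "card {k :: 'a^'n. \<forall>j. k $ j \<in> S j} = (\<Prod>j\<in>UNIV. card (S j))"
  using bij_betw_same_card[OF bij_betw_vec_box, of S] by (simp add: card_PiE)

lemma finite_freqs [simp]: "finite (freqs n)"
  unfolding freqs_def
  using bij_betw_finite[OF bij_betw_vec_box, of "\<lambda>_. {0..int n}"] by (simp add: finite_PiE)

lemma card_freqs: "card (freqs n) = (n + 1) ^ 3"
  unfolding freqs_def card_vec_box by (simp add: nat_add_distrib)

lemma card_freqs_pos [simp]: "card (freqs n) > 0"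
  by (simp add: card_freqs)

lemma freqs_nonempty [simp]: "freqs n \<noteq> {}"
  using card_freqs_pos[of n] by fastforce

text \<open>A unit shift excludes only the value n of coordinate \<open>j\<close>. Relative to (n +
  1)^3 this leaves the fraction n / (n + 1), the first Fourier coefficient of the kernel.\<close>

lemma card_freqs_shift: "card {k \<in> freqs n. k + axis j 1 \<in> freqs n} = n * (n + 1)\<^sup>2"
proof -
  have "{k \<in> freqs n. k + axis j 1 \<in> freqs n}
      = {k. \<forall>i. k $ i \<in> (if i = j then {0..int n - 1} else {0..int n})}"
  proof (rule set_eqI)
    fix k :: "int^3"
    have "k \<in> {k \<in> freqs n. k + axis j 1 \<in> freqs n} \<longleftrightarrow>
        (\<forall>i. k $ i \<in> {0..int n} \<and> k $ i + axis j 1 $ i \<in> {0..int n})"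
      unfolding freqs_def mem_Collect_eq vector_add_component by blast
    also have "\<dots> \<longleftrightarrow> (\<forall>i. k $ i \<in> (if i = j then {0..int n - 1} else {0..int n}))"
      by (rule iff_allI) (auto simp: axis_def)
    finally show "k \<in> {k \<in> freqs n. k + axis j 1 \<in> freqs n} \<longleftrightarrow>
        k \<in> {k. \<forall>i. k $ i \<in> (if i = j then {0..int n - 1} else {0..int n})}" by simp
  qed
  also have "card \<dots> = (\<Prod>i\<in>UNIV. if i = j then n else n + 1)"
    unfolding card_vec_box by (intro prod.cong) (auto simp: nat_add_distrib)
  also have "\<dots> = n * (n + 1)\<^sup>2"
    by (subst prod.remove[of _ j]) (simp_all add: card_Diff_singleton)
  finally show ?thesis .
qed

lemma wavevec_diff: "wavevec l (k - k') = wavevec l k - wavevec l k'"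
  by (simp add: vec_eq_iff wavevec_def diff_divide_distrib algebra_simps)

lemma wavevec_add: "wavevec l (k + k') = wavevec l k + wavevec l k'"
  by (simp add: vec_eq_iff wavevec_def add_divide_distrib algebra_simps)

lemma fejer_nonneg: "fejer l n z \<ge> 0"
  by (simp add: fejer_def)

lemma fejer_conv_sum:
  "complex_of_real (fejer l n z) =
    (\<Sum>i\<in>freqs n \<times> freqs n. cis (wavevec l (fst i - snd i) \<bullet> z)) / of_nat (card (freqs n))"
proof -
  have "(\<Sum>i\<in>freqs n \<times> freqs n. cis (wavevec l (fst i - snd i) \<bullet> z))
      = (\<Sum>k\<in>freqs n. \<Sum>k'\<in>freqs n. cis (wavevec l k \<bullet> z) * cnj (cis (wavevec l k' \<bullet> z)))"
    by (simp add: sum.cartesian_product case_prod_unfold cis_cnj cis_mult wavevec_diff inner_diff_left)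
  also have "\<dots> = (\<Sum>k\<in>freqs n. cis (wavevec l k \<bullet> z)) * cnj (\<Sum>k\<in>freqs n. cis (wavevec l k \<bullet> z))"
    by (simp add: sum_product cnj_sum)
  also have "\<dots> = of_real ((cmod (\<Sum>k\<in>freqs n. cis (wavevec l k \<bullet> z)))\<^sup>2)"
    using complex_norm_square[of "\<Sum>k\<in>freqs n. cis (wavevec l k \<bullet> z)"] by simp
  finally show ?thesis by (simp add: fejer_def)
qed

lemma fejer_minus: "fejer l n (- z) = fejer l n z"
proof -
  have "(\<Sum>k\<in>freqs n. cis (wavevec l k \<bullet> - z)) = cnj (\<Sum>k\<in>freqs n. cis (wavevec l k \<bullet> z))"
    by (simp add: cis_cnj)
  then show ?thesis unfolding fejer_def by (metis complex_mod_cnj)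
qed

lemma fejer_commute: "fejer l n (x - y) = fejer l n (y - x)"
  using fejer_minus[of l n "x - y"] by simp

lemma continuous_on_fejer: "continuous_on UNIV f \<Longrightarrow> continuous_on UNIV (\<lambda>x. fejer l n (f x))"
  unfolding fejer_def cis_conv_exp by (intro continuous_intros) auto

lemma fejer_measurable [measurable]: "fejer l n \<in> borel_measurable borel"
  by (intro borel_measurable_continuous_onI continuous_on_fejer continuous_on_id)

lemma fejer_le: "fejer l n z \<le> real (card (freqs n))"
proof -
  have "cmod (\<Sum>k\<in>freqs n. cis (wavevec l k \<bullet> z)) \<le> (\<Sum>k\<in>freqs n. cmod (cis (wavevec l k \<bullet> z)))"
    by (rule norm_sum)
  then have "(cmod (\<Sum>k\<in>freqs n. cis (wavevec l k \<bullet> z)))\<^sup>2 \<le> (real (card (freqs n)))\<^sup>2"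
    by (intro power_mono) auto
  then show ?thesis by (simp add: fejer_def divide_le_eq power2_eq_square)
qed

text \<open>The case p = 0 gives the total mass of the kernel, and unit vectors p give the
  trigonometric moments for Korovkin's argument.\<close>

lemma fejer_wave_integral:
  assumes l: "\<And>j. l $ j > 0"
  shows "(\<integral>y. complex_of_real (fejer l n (y - x)) * cis (wavevec l p \<bullet> (y - x)) \<partial>boxm l)
    = of_real (vol l * card {k \<in> freqs n. k + p \<in> freqs n} / card (freqs n))"
proof -
  let ?G = "freqs n"
  have e: "complex_of_real (fejer l n (y - x)) * cis (wavevec l p \<bullet> (y - x))
      = (\<Sum>i\<in>?G \<times> ?G. cis (- (wavevec l (fst i - snd i + p) \<bullet> x)) / of_nat (card ?G)
          * cis (wavevec l (fst i - snd i + p) \<bullet> y))" for y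
    unfolding fejer_conv_sum sum_divide_distrib sum_distrib_right
    by (intro sum.cong refl)
      (simp add: cis_mult wavevec_add wavevec_diff inner_add_left inner_diff_left inner_diff_right algebra_simps)
  have int: "integrable (boxm l) (\<lambda>y. cis (wavevec l q \<bullet> y))" for q
    unfolding cis_conv_exp by (intro integrable_boxm_continuous continuous_intros)
  have "(\<integral>y. complex_of_real (fejer l n (y - x)) * cis (wavevec l p \<bullet> (y - x)) \<partial>boxm l)
      = (\<Sum>i\<in>?G \<times> ?G. cis (- (wavevec l (fst i - snd i + p) \<bullet> x)) / of_nat (card ?G)
          * (if fst i - snd i + p = 0 then of_real (vol l) else 0))"
    unfolding e
    by (subst Bochner_Integration.integral_sum) (auto simp: int wave_integral[OF l])
  \<comment> \<open>A pair survives only if its total frequency vanishes; its phase in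
    \<open>x\<close> is then 1, so the result does not depend on \<open>x\<close>.\<close>
  also have "\<dots> = (\<Sum>i\<in>?G \<times> ?G. if snd i = fst i + p then of_real (vol l) / of_nat (card ?G) else 0)"
    by (intro sum.cong) (auto simp: wavevec_def algebra_simps zero_vec_def[symmetric])
  also have "\<dots> = (\<Sum>k\<in>?G. \<Sum>k'\<in>?G. if k' = k + p then of_real (vol l) / of_nat (card ?G) else 0)"
    by (simp only: sum.cartesian_product case_prod_unfold)
  also have "\<dots> = (\<Sum>k\<in>?G. if k + p \<in> ?G then of_real (vol l) / of_nat (card ?G) else 0)"
    by (simp add: sum.delta)
  also have "\<dots> = (\<Sum>k\<in>{k\<in>?G. k + p \<in> ?G}. of_real (vol l) / of_nat (card ?G))"
    by (rule sum.inter_filter[symmetric]) simp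
  finally show ?thesis by simp
qed

lemma fejer_integral:
  assumes l: "\<And>j. l $ j > 0"
  shows "(\<integral>y. fejer l n (y - x) \<partial>boxm l) = vol l"
proof -
  have "complex_of_real (\<integral>y. fejer l n (y - x) \<partial>boxm l)
      = (\<integral>y. complex_of_real (fejer l n (y - x)) * cis (wavevec l 0 \<bullet> (y - x)) \<partial>boxm l)"
    by (simp add: wavevec_def zero_vec_def[symmetric])
  also have "\<dots> = of_real (vol l)" by (simp add: fejer_wave_integral[OF l])
  finally show ?thesis by (simp only: of_real_eq_iff)
qed

text \<open>Here 1 - cos plays the role of the squared distance in Korovkin's criterion. Its moment
  is the defect 1 - n / (n + 1) times the volume and tends to 0.\<close>

lemma fejer_cos_integral:
  assumes l: "\<And>j. l $ j > 0"
  shows "(\<integral>y. fejer l n (y - x) * (1 - cos (2 * pi * (y $ j - x $ j) / l $ j)) \<partial>boxm l)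
    = vol l / (n + 1)"
proof -
  have w: "wavevec l (axis j 1) \<bullet> z = 2 * pi * z $ j / l $ j" for z
  proof -
    have "wavevec l (axis j 1) = (2 * pi / l $ j) *\<^sub>R axis j 1"
      by (auto simp: vec_eq_iff wavevec_def axis_def)
    then show ?thesis by (simp add: inner_axis')
  qed
  have i1: "integrable (boxm l) (\<lambda>y. fejer l n (y - x))"
    by (intro integrable_boxm_continuous continuous_on_fejer continuous_intros)
  have i2: "integrable (boxm l) (\<lambda>y. complex_of_real (fejer l n (y - x)) * cis (wavevec l (axis j 1) \<bullet> (y - x)))"
    unfolding cis_conv_exp
    by (intro integrable_boxm_continuous continuous_intros continuous_on_fejer)
  have "(\<integral>y. fejer l n (y - x) * cos (2 * pi * (y $ j - x $ j) / l $ j) \<partial>boxm l)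
      = (\<integral>y. Re (complex_of_real (fejer l n (y - x)) * cis (wavevec l (axis j 1) \<bullet> (y - x))) \<partial>boxm l)"
    by (simp add: w)
  also have "\<dots> = vol l * (n * (n + 1)\<^sup>2) / (n + 1) ^ 3"
    using i2 by (subst integral_Re) (simp_all only: fejer_wave_integral[OF l] card_freqs_shift card_freqs Re_complex_of_real)
  also have "\<dots> = vol l * (n / (n + 1))"
  proof -
    have "vol l * (real n * m\<^sup>2) / m ^ 3 = vol l * (real n / m)" if "m \<noteq> 0" for m
      using that by (simp add: power2_eq_square power3_eq_cube)
    from this[of "real n + 1"] show ?thesis by (simp add: add.commute)
  qed
  finally have "(\<integral>y. fejer l n (y - x) * cos (2 * pi * (y $ j - x $ j) / l $ j) \<partial>boxm l) = vol l * (n / (n + 1))" .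
  moreover have "integrable (boxm l) (\<lambda>y. fejer l n (y - x) * cos (2 * pi * (y $ j - x $ j) / l $ j))"
    by (intro integrable_boxm_continuous continuous_intros continuous_on_fejer)
      (use l[of j] in auto)
  ultimately show ?thesis
    using i1 by (simp add: right_diff_distrib fejer_integral[OF l]) (simp add: field_simps)
qed

section \<open>Fejer means of integrable matrix fields as convolutions\<close>

definition cplx :: "rmat \<Rightarrow> cmat" where
  "cplx A = (\<chi> i j. complex_of_real (A $ i $ j))"

lemma norm_sq_rmat: "(norm (A::rmat))\<^sup>2 = (\<Sum>i\<in>UNIV. \<Sum>j\<in>UNIV. (A $ i $ j)\<^sup>2)"
  by (simp add: power2_norm_eq_inner inner_vec_def) (simp add: power2_eq_square)

lemma frob_eq_norm: "frob A = norm A"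
  unfolding frob_def norm_sq_rmat[symmetric] by simp

lemma norm_cplx: "norm (cplx A) = norm A"
proof -
  have "(norm (cplx A))\<^sup>2 = (norm A)\<^sup>2"
    by (simp add: norm_sq_cmat norm_sq_rmat cplx_def)
  then show ?thesis by (simp add: power2_eq_iff_nonneg)
qed

lemma vol_pos: "(\<And>j. l $ j > 0) \<Longrightarrow> vol l > 0"
  unfolding vol_def by (rule prod_pos) auto

lemma integrable_matI:
  fixes f :: "'a \<Rightarrow> rmat"
  assumes "\<And>i j. integrable M (\<lambda>x. f x $ i $ j)"
  shows "integrable M f"
proof -
  have "f x = (\<Sum>i\<in>UNIV. \<Sum>j\<in>UNIV. (f x $ i $ j) *\<^sub>R axis i (axis j 1))" for x
    by (simp add: vec_eq_iff axis_def forall_3 sum_3)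
  then have f: "f = (\<lambda>x. \<Sum>i\<in>UNIV. \<Sum>j\<in>UNIV. (f x $ i $ j) *\<^sub>R axis i (axis j 1))"
    by blast
  show ?thesis
    by (subst f) (intro Bochner_Integration.integrable_sum integrable_scaleR_left assms)
qed

lemma bounded_linear_mat_nth: "bounded_linear (\<lambda>A :: rmat. A $ i $ j)"
  by (intro bounded_linear_compose[OF bounded_linear_vec_nth] bounded_linear_vec_nth)

lemma integrable_fejer_scaleR:
  fixes f :: "real^3 \<Rightarrow> 'b::{banach, second_countable_topology}"
  assumes "integrable (boxm l) f"
  shows "integrable (boxm l) (\<lambda>y. fejer l n (x - y) *\<^sub>R f y)"
  by (rule integrable_scaleR_bounded[OF assms, where B = "real (card (freqs n))"])
    (auto simp: fejer_nonneg fejer_le intro!: borel_measurable_boxm)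

text \<open>Exchanging the finite sum with the integral turns the mean into convolution with the
  kernel. The result is a real matrix, which links complex estimates for the semigroup with real
  estimates for the field.\<close>

lemma fejer_mean_mcoef:
  assumes l: "\<And>j. l $ j > 0" and f: "integrable (boxm l) f"
  shows "fejer_mean l n (mcoef l f) x = cplx ((1 / vol l) *\<^sub>R (\<integral>y. fejer l n (x - y) *\<^sub>R f y \<partial>boxm l))"
proof -
  let ?G = "freqs n"
  have fij: "integrable (boxm l) (\<lambda>x. f x $ i $ j)" for i j
    using integrable_bounded_linear[OF bounded_linear_mat_nth f] .
  have "fejer_mean l n (mcoef l f) x $ i $ j
      = of_real (1 / vol l * (\<integral>y. fejer l n (x - y) * f y $ i $ j \<partial>boxm l))" for i j
  proof -
    have m: "mcoef l f k $ i $ j = of_real (1 / vol l) * (\<integral>y. (f y $ i $ j) *\<^sub>R cis (- (wavevec l k \<bullet> y)) \<partial>boxm l)" for k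
      by (simp add: mcoef_def fcoef_def vol_def set_integral_boxm cis_conv_exp scaleR_conv_of_real)
    have int: "integrable (boxm l) (\<lambda>y. (f y $ i $ j) *\<^sub>R cis (- (wavevec l k \<bullet> y)))" for k
    proof (rule integrable_scaleR_bounded_right[OF fij])
      show "(\<lambda>y. cis (- (wavevec l k \<bullet> y))) \<in> borel_measurable (boxm l)"
        unfolding cis_conv_exp
        by (intro borel_measurable_boxm borel_measurable_continuous_onI continuous_intros)
      show "norm (cis (- (wavevec l k \<bullet> y))) \<le> 1" for y by simp
    qed
    have "fejer_mean l n (mcoef l f) x $ i $ j = (\<Sum>p\<in>?G \<times> ?G.
        of_real (1 / vol l) * (cis (wavevec l (fst p - snd p) \<bullet> x) / of_nat (card ?G) *
          (\<integral>y. (f y $ i $ j) *\<^sub>R cis (- (wavevec l (fst p - snd p) \<bullet> y)) \<partial>boxm l)))"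
      unfolding fejer_mean_def
      by (simp add: m scaleR_conv_of_real[where 'a = complex] mult_ac del: of_real_divide)
        (simp add: field_simps)
    also have "\<dots> = of_real (1 / vol l) * (\<Sum>p\<in>?G \<times> ?G.
         \<integral>y. cis (wavevec l (fst p - snd p) \<bullet> x) / of_nat (card ?G) *
          ((f y $ i $ j) *\<^sub>R cis (- (wavevec l (fst p - snd p) \<bullet> y))) \<partial>boxm l)"
      unfolding sum_distrib_left integral_mult_right_zero ..
    also have "(\<Sum>p\<in>?G \<times> ?G.
         \<integral>y. cis (wavevec l (fst p - snd p) \<bullet> x) / of_nat (card ?G) *
          ((f y $ i $ j) *\<^sub>R cis (- (wavevec l (fst p - snd p) \<bullet> y))) \<partial>boxm l)
       = (\<integral>y. (\<Sum>p\<in>?G \<times> ?G. cis (wavevec l (fst p - snd p) \<bullet> x) / of_nat (card ?G) *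
          ((f y $ i $ j) *\<^sub>R cis (- (wavevec l (fst p - snd p) \<bullet> y)))) \<partial>boxm l)"
      by (rule Bochner_Integration.integral_sum[symmetric]) (intro integrable_mult_right int)
    also have "\<dots> = (\<integral>y. complex_of_real (fejer l n (x - y) * f y $ i $ j) \<partial>boxm l)"
      unfolding of_real_mult fejer_conv_sum sum_divide_distrib sum_distrib_right
      by (intro Bochner_Integration.integral_cong sum.cong refl)
        (simp add: scaleR_conv_of_real inner_diff_right cis_mult)
    also have "\<dots> = of_real (\<integral>y. fejer l n (x - y) * f y $ i $ j \<partial>boxm l)"
      by (rule integral_complex_of_real)
    finally show ?thesis by (simp only: of_real_mult)
  qed
  moreover have "(\<integral>y. fejer l n (x - y) *\<^sub>R f y \<partial>boxm l) $ i $ j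
      = (\<integral>y. fejer l n (x - y) * f y $ i $ j \<partial>boxm l)" for i j
    using integral_bounded_linear[OF bounded_linear_mat_nth integrable_fejer_scaleR[OF f], of n x i j]
    by simp
  ultimately show ?thesis by (simp add: vec_eq_iff cplx_def)
qed

lemma norm_fejer_mean_le:
  assumes l: "\<And>j. l $ j > 0" and f: "integrable (boxm l) f"
    and bnd: "AE x in boxm l. norm (f x) \<le> c"
  shows "norm (fejer_mean l n (mcoef l f) x) \<le> c"
proof -
  have "norm (\<integral>y. fejer l n (x - y) *\<^sub>R f y \<partial>boxm l) \<le> (\<integral>y. norm (fejer l n (x - y) *\<^sub>R f y) \<partial>boxm l)"
    by (rule integral_norm_bound)
  also have "\<dots> \<le> (\<integral>y. fejer l n (y - x) * c \<partial>boxm l)"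
  proof (rule integral_mono_AE)
    show "integrable (boxm l) (\<lambda>y. norm (fejer l n (x - y) *\<^sub>R f y))"
      by (intro integrable_norm integrable_fejer_scaleR f)
    show "integrable (boxm l) (\<lambda>y. fejer l n (y - x) * c)"
      by (intro integrable_boxm_continuous continuous_intros continuous_on_fejer)
    show "AE y in boxm l. norm (fejer l n (x - y) *\<^sub>R f y) \<le> fejer l n (y - x) * c"
      using bnd by eventually_elim
        (simp add: fejer_nonneg fejer_commute[of l n x] mult_left_mono)
  qed
  also have "\<dots> = vol l * c" by (simp add: fejer_integral[OF l])
  finally show ?thesis
    using vol_pos[OF l] by (simp add: fejer_mean_mcoef[OF l f] norm_cplx divide_le_eq mult.commute)
qed

section \<open>Recovering a bound from the Fejer means\<close>

text \<open>The sum on the right vanishes only if \<open>x\<close> and \<open>y\<close> agree modulo the periods, so compactness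
  bounds it from below where \<open>\<phi>\<close> varies by at least \<open>e\<close>.\<close>

lemma periodic_modulus:
  assumes l: "\<And>j. l $ j > 0" and cont: "continuous_on UNIV \<phi>"
    and bd: "\<And>x j. x \<in> Omega l \<Longrightarrow> x $ j = 0 \<or> x $ j = l $ j \<Longrightarrow> \<phi> x = (0::real)"
    and "e > 0"
  shows "\<exists>C\<ge>0. \<forall>x\<in>Omega l. \<forall>y\<in>Omega l.
     \<bar>\<phi> x - \<phi> y\<bar> \<le> e + C * (\<Sum>j\<in>UNIV. 1 - cos (2 * pi * (x $ j - y $ j) / l $ j))"
proof -
  have l_nz: "l $ j \<noteq> 0" for j using l[of j] by simp
  define w where "w z = (\<Sum>j\<in>UNIV. 1 - cos (2 * pi * (fst z $ j - snd z $ j) / l $ j))" for z :: "(real^3) \<times> (real^3)"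
  define d where "d z = \<bar>\<phi> (fst z) - \<phi> (snd z)\<bar>" for z
  define S where "S = {z \<in> Omega l \<times> Omega l. e \<le> d z}"
  have w0: "w z \<ge> 0" for z unfolding w_def by (rule sum_nonneg) simp
  have contd: "continuous_on T d" for T
    unfolding d_def
    by (intro continuous_intros continuous_on_compose2[OF cont]) auto
  have contw: "continuous_on T w" for T
    unfolding w_def by (intro continuous_intros) (simp_all add: l_nz)
  have cOm: "compact (Omega l \<times> Omega l)" unfolding Omega_def by (intro compact_Times) auto
  have "closed S" unfolding S_def
    by (intro continuous_on_closed_Collect_le contd continuous_intros compact_imp_closed[OF cOm])
  moreover have "S = (Omega l \<times> Omega l) \<inter> S" by (auto simp: S_def)
  ultimately have S: "compact S" using compact_Int_closed[OF cOm, of S] by simp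
  show ?thesis
  proof (cases "S = {}")
    case True
    then have "\<bar>\<phi> x - \<phi> y\<bar> \<le> e" if "x \<in> Omega l" "y \<in> Omega l" for x y
      using that by (force simp: S_def d_def)
    then show ?thesis by (intro exI[of _ 0]) auto
  next
    case False
    obtain z0 where z0: "z0 \<in> S" "\<And>z. z \<in> S \<Longrightarrow> w z0 \<le> w z"
      using continuous_attains_inf[OF S False contw] by blast
    obtain z1 where z1: "\<And>z. z \<in> S \<Longrightarrow> d z \<le> d z1"
      using continuous_attains_sup[OF S False contd] by blast
    have "w z0 \<noteq> 0"
    proof
      assume "w z0 = 0"
      obtain x y where xy: "z0 = (x, y)" by (cases z0)
      have Om: "x \<in> Omega l" "y \<in> Omega l" and d: "e \<le> \<bar>\<phi> x - \<phi> y\<bar>"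
        using z0(1) by (auto simp: S_def xy d_def)
      have "cos (2 * pi * (x $ j - y $ j) / l $ j) = 1" for j
      proof -
        have "\<forall>j\<in>UNIV. 1 - cos (2 * pi * (x $ j - y $ j) / l $ j) = 0"
          using \<open>w z0 = 0\<close> unfolding w_def xy by (subst (asm) sum_nonneg_eq_0_iff) auto
        then show ?thesis by auto
      qed
      \<comment> \<open>The difference is m periods with |m| \<le> 1, and m = 1 or m = -1 puts the
        two coordinates at opposite ends of the interval, where \<phi> vanishes.\<close>
      have j: "x $ j = y $ j \<or> (x $ j = 0 \<or> x $ j = l $ j) \<and> (y $ j = 0 \<or> y $ j = l $ j)" for j
      proof -
        have "cos (2 * pi * (x $ j - y $ j) / l $ j) = 1" by fact
        then obtain m :: int where "2 * pi * (x $ j - y $ j) / l $ j = of_int m * 2 * pi"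
          unfolding cos_one_2pi_int by blast
        then have "2 * pi * ((x $ j - y $ j) / l $ j) = 2 * pi * of_int m" by simp
        then have "(x $ j - y $ j) / l $ j = of_int m" unfolding mult_cancel_left by simp
        then have m: "x $ j - y $ j = of_int m * l $ j" using l[of j] by (simp add: field_simps)
        have b: "0 \<le> x $ j" "x $ j \<le> l $ j" "0 \<le> y $ j" "y $ j \<le> l $ j"
          using Om by (auto simp: Omega_def mem_box_cart)
        have "real_of_int m * l $ j \<le> 1 * l $ j" "(-1) * l $ j \<le> real_of_int m * l $ j"
          using m b by linarith+
        then have "real_of_int m \<le> 1" "-1 \<le> real_of_int m"
          using l[of j] mult_le_cancel_right_pos by blast+
        then have "m = 0 \<or> m = 1 \<or> m = -1" by linarith
        then show ?thesis using m b by auto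
      qed
      show False
      proof (cases "x = y")
        case True
        then show ?thesis using d \<open>e > 0\<close> by simp
      next
        case False
        then obtain j where "x $ j \<noteq> y $ j" by (auto simp: vec_eq_iff)
        with j have "\<phi> x = 0" "\<phi> y = 0" using bd Om by blast+
        then show ?thesis using d \<open>e > 0\<close> by simp
      qed
    qed
    with w0[of z0] have wp: "w z0 > 0" by simp
    have "d z1 \<ge> 0" by (simp add: d_def)
    show ?thesis
    \<comment> \<open>The largest oscillation on \<open>S\<close> over the smallest value of
      \<open>w\<close> there; off \<open>S\<close> the term \<open>e\<close> alone suffices.\<close>
    proof (intro exI[of _ "d z1 / w z0"] conjI ballI)
      show "d z1 / w z0 \<ge> 0" using \<open>d z1 \<ge> 0\<close> wp by simp
      fix x y assume xy: "x \<in> Omega l" "y \<in> Omega l"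
      have "d (x, y) \<le> e + d z1 / w z0 * w (x, y)"
      proof (cases "(x, y) \<in> S")
        case True
        have "d (x, y) \<le> d z1 / w z0 * w z0" using z1[OF True] wp by simp
        also have "\<dots> \<le> d z1 / w z0 * w (x, y)"
          using z0(2)[OF True] \<open>d z1 \<ge> 0\<close> wp by (intro mult_left_mono) auto
        finally show ?thesis using \<open>e > 0\<close> by simp
      next
        case False
        moreover have "d z1 / w z0 * w (x, y) \<ge> 0" using \<open>d z1 \<ge> 0\<close> wp w0 by simp
        ultimately show ?thesis using xy by (auto simp: S_def)
      qed
      then show "\<bar>\<phi> x - \<phi> y\<bar> \<le> e + d z1 / w z0 * (\<Sum>j\<in>UNIV. 1 - cos (2 * pi * (x $ j - y $ j) / l $ j))"
        by (simp add: d_def w_def)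
    qed
  qed
qed

text \<open>The kernel has mass \<open>vol l\<close>, so the error is an average of \<phi> x -
  \<phi> y. The modulus estimate splits it into e / 2 and three cosine moments of size vol l / (n +
  1), uniformly in y. Vanishing on the faces makes the periodic extension of \<phi>
  continuous.\<close>

lemma fejer_uniform_approx:
  assumes l: "\<And>j. l $ j > 0" and cont: "continuous_on UNIV \<phi>"
    and bd: "\<And>x j. x \<in> Omega l \<Longrightarrow> x $ j = 0 \<or> x $ j = l $ j \<Longrightarrow> \<phi> x = (0::real)"
    and "e > 0"
  shows "\<exists>n. \<forall>y\<in>Omega l. \<bar>(\<integral>x. \<phi> x * fejer l n (x - y) \<partial>boxm l) - vol l * \<phi> y\<bar> \<le> vol l * e"
proof -
  have l_nz: "l $ j \<noteq> 0" for j using l[of j] by simp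
  obtain C where C: "C \<ge> 0" "\<And>x y. x \<in> Omega l \<Longrightarrow> y \<in> Omega l \<Longrightarrow>
     \<bar>\<phi> x - \<phi> y\<bar> \<le> e / 2 + C * (\<Sum>j\<in>UNIV. 1 - cos (2 * pi * (x $ j - y $ j) / l $ j))"
  proof -
    have "\<exists>C\<ge>0. \<forall>x\<in>Omega l. \<forall>y\<in>Omega l.
        \<bar>\<phi> x - \<phi> y\<bar> \<le> e / 2 + C * (\<Sum>j\<in>UNIV. 1 - cos (2 * pi * (x $ j - y $ j) / l $ j))"
      using l cont bd half_gt_zero[OF \<open>e > 0\<close>] by (rule periodic_modulus)
    then show ?thesis using that by blast
  qed
  obtain n where n: "3 * C / (e / 2) < real n" using reals_Archimedean2 by blast
  have nC: "3 * C / (real n + 1) \<le> e / 2"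
  proof -
    have "3 * C < real n * (e / 2)" using n \<open>e > 0\<close> by (simp add: pos_divide_less_eq)
    also have "\<dots> \<le> (real n + 1) * (e / 2)" using \<open>e > 0\<close> by (intro mult_right_mono) auto
    finally show ?thesis by (simp add: pos_divide_le_eq mult.commute)
  qed
  show ?thesis
  proof (intro exI[of _ n] ballI)
    fix y assume y: "y \<in> Omega l"
    let ?K = "\<lambda>x. fejer l n (x - y)"
    let ?c = "\<lambda>j x. ?K x * (1 - cos (2 * pi * (x $ j - y $ j) / l $ j))"
    have i1: "integrable (boxm l) (\<lambda>x. \<phi> x * ?K x)"
      by (intro integrable_boxm_continuous continuous_intros continuous_on_fejer cont)
    have i2: "integrable (boxm l) ?K"
      by (intro integrable_boxm_continuous continuous_intros continuous_on_fejer)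
    have i3: "integrable (boxm l) (?c j)" for j
      by (intro integrable_boxm_continuous continuous_intros continuous_on_fejer) (simp add: l_nz)
    have "(\<integral>x. \<phi> x * ?K x \<partial>boxm l) - vol l * \<phi> y = (\<integral>x. \<phi> x * ?K x - \<phi> y * ?K x \<partial>boxm l)"
      using i1 i2 by (simp add: fejer_integral[OF l])
    also have "\<bar>\<dots>\<bar> \<le> (\<integral>x. \<bar>\<phi> x * ?K x - \<phi> y * ?K x\<bar> \<partial>boxm l)"
      by (rule integral_abs_bound)
    also have "\<dots> \<le> (\<integral>x. e / 2 * ?K x + C * (\<Sum>j\<in>UNIV. ?c j x) \<partial>boxm l)"
    proof (rule integral_mono)
      show "integrable (boxm l) (\<lambda>x. \<bar>\<phi> x * ?K x - \<phi> y * ?K x\<bar>)"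
        by (intro integrable_abs Bochner_Integration.integrable_diff integrable_mult_right i1 i2)
      show "integrable (boxm l) (\<lambda>x. e / 2 * ?K x + C * (\<Sum>j\<in>UNIV. ?c j x))"
        using i2 i3 by (intro Bochner_Integration.integrable_add integrable_mult_right
            Bochner_Integration.integrable_sum) auto
      fix x assume "x \<in> space (boxm l)"
      then have "\<bar>\<phi> x - \<phi> y\<bar> * ?K x
          \<le> (e / 2 + C * (\<Sum>j\<in>UNIV. 1 - cos (2 * pi * (x $ j - y $ j) / l $ j))) * ?K x"
        by (intro mult_right_mono fejer_nonneg C(2) y) simp
      also have "\<dots> = e / 2 * ?K x + C * (\<Sum>j\<in>UNIV. ?c j x)"
      proof -
        have "(\<Sum>j\<in>UNIV. 1 - cos (2 * pi * (x $ j - y $ j) / l $ j)) * ?K x = (\<Sum>j\<in>UNIV. ?c j x)"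
          unfolding sum_distrib_right by (intro sum.cong refl mult.commute)
        then show ?thesis by (simp only: distrib_right mult.assoc)
      qed
      finally show "\<bar>\<phi> x * ?K x - \<phi> y * ?K x\<bar> \<le> e / 2 * ?K x + C * (\<Sum>j\<in>UNIV. ?c j x)"
        by (simp only: left_diff_distrib[symmetric] abs_mult abs_of_nonneg[OF fejer_nonneg])
    qed
    also have "\<dots> = e / 2 * vol l + C * (\<Sum>j\<in>(UNIV :: 3 set). vol l / (n + 1))"
    proof -
      have "integrable (boxm l) (\<lambda>x. \<Sum>j\<in>UNIV. ?c j x)"
        by (intro Bochner_Integration.integrable_sum i3)
      moreover have "(\<integral>x. (\<Sum>j\<in>UNIV. ?c j x) \<partial>boxm l) = (\<Sum>j\<in>(UNIV :: 3 set). vol l / (n + 1))"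
        by (subst Bochner_Integration.integral_sum[OF i3]) (simp only: fejer_cos_integral[OF l])
      ultimately show ?thesis
        using i2 by (subst Bochner_Integration.integral_add) (auto simp: fejer_integral[OF l])
    qed
    also have "\<dots> = vol l * (e / 2 + 3 * C / (real n + 1))" by (simp add: field_simps)
    also have "\<dots> \<le> vol l * e" using nC vol_pos[OF l] by (intro mult_left_mono) auto
    finally show "\<bar>(\<integral>x. \<phi> x * ?K x \<partial>boxm l) - vol l * \<phi> y\<bar> \<le> vol l * e" .
  qed
qed

text \<open>Fubini moves the kernel from \<open>g\<close> to the test function. The bound on the
  means of \<open>g\<close> controls the double integral, while uniform convergence of the means of
  \<phi> is paired with the L1 norm of \<open>g\<close>, the only size information about
  \<open>g\<close> at hand.\<close>

lemma fejer_test_integral_le: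
  assumes l: "\<And>j. l $ j > 0" and g: "integrable (boxm l) g"
    and bnd: "\<And>n x. (\<integral>y. fejer l n (x - y) * g y \<partial>boxm l) \<le> vol l * c"
    and cont: "continuous_on UNIV \<phi>"
    and bd: "\<And>x j. x \<in> Omega l \<Longrightarrow> x $ j = 0 \<or> x $ j = l $ j \<Longrightarrow> \<phi> x = (0::real)"
    and nonneg: "\<And>x. x \<in> Omega l \<Longrightarrow> \<phi> x \<ge> 0"
  shows "(\<integral>x. g x * \<phi> x \<partial>boxm l) \<le> c * (\<integral>x. \<phi> x \<partial>boxm l)"
proof -
  interpret B: finite_measure "boxm l" by (rule finite_measure_boxm)
  interpret P: pair_sigma_finite "boxm l" "boxm l" ..
  have V: "vol l > 0" by (rule vol_pos[OF l])
  have phi_int: "integrable (boxm l) \<phi>" by (rule integrable_boxm_continuous[OF cont])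
  have phi_m: "\<phi> \<in> borel_measurable (boxm l)" using phi_int by simp
  have g_m: "g \<in> borel_measurable (boxm l)" using g by simp
  have K_m: "(\<lambda>z. fejer l n (fst z - snd z)) \<in> borel_measurable (boxm l \<Otimes>\<^sub>M boxm l)" for n
  proof -
    have id: "(\<lambda>x. x) \<in> borel_measurable (boxm l)"
      by (rule borel_measurable_boxm) simp
    have "(\<lambda>z. fst z - snd z) \<in> borel_measurable (boxm l \<Otimes>\<^sub>M boxm l)"
      by (intro borel_measurable_diff measurable_compose[OF measurable_fst id]
          measurable_compose[OF measurable_snd id])
    then show ?thesis by (rule measurable_compose[OF _ fejer_measurable])
  qed
  have prod_int: "integrable (boxm l \<Otimes>\<^sub>M boxm l) (\<lambda>z. \<phi> (fst z) * g (snd z))"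
  proof (rule P.Fubini_integrable)
    show "(\<lambda>z. \<phi> (fst z) * g (snd z)) \<in> borel_measurable (boxm l \<Otimes>\<^sub>M boxm l)"
      by (intro borel_measurable_times measurable_compose[OF measurable_fst phi_m]
          measurable_compose[OF measurable_snd g_m])
    show "integrable (boxm l) (\<lambda>x. \<integral>y. norm (\<phi> (fst (x, y)) * g (snd (x, y))) \<partial>boxm l)"
      using phi_int by (simp add: abs_mult)
    show "AE x in boxm l. integrable (boxm l) (\<lambda>y. \<phi> (fst (x, y)) * g (snd (x, y)))"
      using g by simp
  qed
  have key: "(\<integral>y. g y * \<phi> y \<partial>boxm l) \<le> c * (\<integral>x. \<phi> x \<partial>boxm l) + e * (\<integral>y. \<bar>g y\<bar> \<partial>boxm l)" if "e > 0" for e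
  proof -
    obtain n where n: "\<And>y. y \<in> Omega l \<Longrightarrow>
        \<bar>(\<integral>x. \<phi> x * fejer l n (x - y) \<partial>boxm l) - vol l * \<phi> y\<bar> \<le> vol l * e"
    proof -
      have "\<exists>n. \<forall>y\<in>Omega l. \<bar>(\<integral>x. \<phi> x * fejer l n (x - y) \<partial>boxm l) - vol l * \<phi> y\<bar> \<le> vol l * e"
        using l cont bd \<open>e > 0\<close> by (rule fejer_uniform_approx)
      then show ?thesis using that by blast
    qed
    let ?K = "\<lambda>x y. fejer l n (x - y)"
    let ?F = "\<lambda>x y. ?K x y * (\<phi> x * g y)"
    have F: "integrable (boxm l \<Otimes>\<^sub>M boxm l) (case_prod ?F)"
      using integrable_scaleR_bounded[OF prod_int K_m[of n], of "real (card (freqs n))"]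
      by (simp add: fejer_nonneg fejer_le case_prod_unfold)
    have swap: "(\<integral>y. (\<integral>x. ?F x y \<partial>boxm l) \<partial>boxm l) = (\<integral>x. (\<integral>y. ?F x y \<partial>boxm l) \<partial>boxm l)"
      by (rule P.Fubini_integral[OF F])
    have iy: "integrable (boxm l) (\<lambda>y. \<integral>x. ?F x y \<partial>boxm l)" using P.integrable_snd[OF F] .
    have ix: "integrable (boxm l) (\<lambda>x. \<integral>y. ?F x y \<partial>boxm l)" using P.integrable_fst[OF F] .
    have Fy: "(\<integral>x. ?F x y \<partial>boxm l) = g y * (\<integral>x. \<phi> x * ?K x y \<partial>boxm l)" for y
    proof -
      have "(\<integral>x. ?F x y \<partial>boxm l) = (\<integral>x. g y * (\<phi> x * ?K x y) \<partial>boxm l)"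
        by (intro Bochner_Integration.integral_cong refl) (simp only: mult_ac)
      then show ?thesis by (simp only: integral_mult_right_zero)
    qed
    have Fx: "(\<integral>y. ?F x y \<partial>boxm l) = \<phi> x * (\<integral>y. ?K x y * g y \<partial>boxm l)" for x
    proof -
      have "(\<integral>y. ?F x y \<partial>boxm l) = (\<integral>y. \<phi> x * (?K x y * g y) \<partial>boxm l)"
        by (intro Bochner_Integration.integral_cong refl) (simp only: mult_ac)
      then show ?thesis by (simp only: integral_mult_right_zero)
    qed
    have gphi: "integrable (boxm l) (\<lambda>y. g y * \<phi> y)"
    proof -
      have "compact (\<phi> ` Omega l)"
        unfolding Omega_def by (intro compact_continuous_image continuous_on_subset[OF cont]) auto
      then obtain B where "\<And>x. x \<in> Omega l \<Longrightarrow> norm (\<phi> x) \<le> B"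
        by (meson compact_imp_bounded bounded_iff imageI)
      then show ?thesis
        using integrable_scaleR_bounded_right[OF g phi_m, of B] by simp
    qed
    have "vol l * (\<integral>y. g y * \<phi> y \<partial>boxm l) - (\<integral>y. (\<integral>x. ?F x y \<partial>boxm l) \<partial>boxm l)
        = (\<integral>y. vol l * (g y * \<phi> y) - (\<integral>x. ?F x y \<partial>boxm l) \<partial>boxm l)"
      by (simp only: Bochner_Integration.integral_diff[OF integrable_mult_right[OF gphi] iy]
          integral_mult_right_zero)
    also have "\<dots> \<le> (\<integral>y. (vol l * e) * \<bar>g y\<bar> \<partial>boxm l)"
    proof (rule integral_mono)
      show "integrable (boxm l) (\<lambda>y. vol l * (g y * \<phi> y) - (\<integral>x. ?F x y \<partial>boxm l))"
        by (intro Bochner_Integration.integrable_diff integrable_mult_right gphi iy)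
      show "integrable (boxm l) (\<lambda>y. (vol l * e) * \<bar>g y\<bar>)"
        by (intro integrable_mult_right integrable_abs g)
      fix y assume "y \<in> space (boxm l)"
      then have y: "y \<in> Omega l" by simp
      have "vol l * (g y * \<phi> y) - (\<integral>x. ?F x y \<partial>boxm l)
          = g y * - ((\<integral>x. \<phi> x * ?K x y \<partial>boxm l) - vol l * \<phi> y)"
        unfolding Fy by (simp add: algebra_simps)
      also have "\<dots> \<le> \<bar>g y\<bar> * \<bar>(\<integral>x. \<phi> x * ?K x y \<partial>boxm l) - vol l * \<phi> y\<bar>"
        by (rule order_trans[OF abs_ge_self]) (simp only: abs_mult abs_minus_cancel order_refl)
      also have "\<dots> \<le> \<bar>g y\<bar> * (vol l * e)" by (intro mult_left_mono n y) simp
      finally show "vol l * (g y * \<phi> y) - (\<integral>x. ?F x y \<partial>boxm l) \<le> (vol l * e) * \<bar>g y\<bar>"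
        by (subst (2) mult.commute)
    qed
    also have "\<dots> = vol l * (e * (\<integral>y. \<bar>g y\<bar> \<partial>boxm l))" by simp
    finally have 1: "vol l * (\<integral>y. g y * \<phi> y \<partial>boxm l)
        \<le> (\<integral>x. (\<integral>y. ?F x y \<partial>boxm l) \<partial>boxm l) + vol l * (e * (\<integral>y. \<bar>g y\<bar> \<partial>boxm l))"
      unfolding swap by simp
    have "(\<integral>x. (\<integral>y. ?F x y \<partial>boxm l) \<partial>boxm l) \<le> (\<integral>x. (vol l * c) * \<phi> x \<partial>boxm l)"
    proof (rule integral_mono[OF ix])
      show "integrable (boxm l) (\<lambda>x. (vol l * c) * \<phi> x)" by (intro integrable_mult_right phi_int)
      fix x assume "x \<in> space (boxm l)"
      then show "(\<integral>y. ?F x y \<partial>boxm l) \<le> (vol l * c) * \<phi> x"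
        unfolding Fx by (subst mult.commute) (intro mult_right_mono bnd nonneg, simp)
    qed
    also have "\<dots> = vol l * (c * (\<integral>x. \<phi> x \<partial>boxm l))" by simp
    finally have "vol l * (\<integral>y. g y * \<phi> y \<partial>boxm l)
        \<le> vol l * (c * (\<integral>x. \<phi> x \<partial>boxm l) + e * (\<integral>y. \<bar>g y\<bar> \<partial>boxm l))"
      using 1 by (simp add: distrib_left)
    then show ?thesis using V by simp
  qed
  define I where "I = (\<integral>y. \<bar>g y\<bar> \<partial>boxm l)"
  have I: "I \<ge> 0" unfolding I_def by (rule Bochner_Integration.integral_nonneg) simp
  show ?thesis
  proof (rule field_le_epsilon)
    fix d :: real assume "d > 0"
    \<comment> \<open>The added 1 keeps the denominator positive when \<open>g\<close> vanishes
      almost everywhere.\<close>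
    have "d / (I + 1) > 0" using \<open>d > 0\<close> I by simp
    moreover have "d / (I + 1) * I \<le> d" using \<open>d > 0\<close> I by (simp add: field_simps)
    ultimately show "(\<integral>x. g x * \<phi> x \<partial>boxm l) \<le> c * (\<integral>x. \<phi> x \<partial>boxm l) + d"
      using key[of "d / (I + 1)"] unfolding I_def by linarith
  qed
qed

section \<open>From continuous test functions to superlevel sets\<close>

lemma bump_tendsto_indicator:
  assumes "closed T" "T \<noteq> {}"
  shows "(\<lambda>i. max 0 (1 - real i * infdist x T)) \<longlonglongrightarrow> indicator T x"
proof (cases "x \<in> T")
  case False
  \<comment> \<open>The distance to the empty set is 0 by convention; nonemptiness of
    \<open>T\<close> is what makes the distance positive off \<open>T\<close>.\<close>
  then have d: "infdist x T > 0"
    using assms in_closed_iff_infdist_zero[of T x] infdist_nonneg[of x T] by simp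
  obtain N where N: "1 / infdist x T < real N" using reals_Archimedean2 by blast
  have "max 0 (1 - real i * infdist x T) = 0" if "i \<ge> N" for i
  proof -
    have "1 < real N * infdist x T" using N d by (simp add: pos_divide_less_eq)
    also have "\<dots> \<le> real i * infdist x T" using that d by (intro mult_right_mono) auto
    finally show ?thesis by simp
  qed
  then have "\<forall>\<^sub>F i in sequentially. max 0 (1 - real i * infdist x T) = 0"
    unfolding eventually_sequentially by blast
  then show ?thesis using False by (simp add: tendsto_eventually)
qed simp

text \<open>A weight that is positive inside the box and vanishes on its boundary, so that the cutoffs of
  \<open>fejer_closed_integral_le\<close> are periodic whatever the closed set is.\<close>

definition sine_bump :: "real^3 \<Rightarrow> real^3 \<Rightarrow> real" where
  "sine_bump l x = (\<Prod>j\<in>UNIV. sin (pi * x $ j / l $ j))"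

lemma continuous_sine_bump:
  assumes l: "\<And>j. l $ j > 0"
  shows "continuous_on S (sine_bump l)"
proof -
  have "l $ j \<noteq> 0" for j using l[of j] by simp
  then show ?thesis unfolding sine_bump_def by (intro continuous_intros) auto
qed

lemma sine_bump_nonneg:
  assumes l: "\<And>j. l $ j > 0" and "x \<in> Omega l"
  shows "sine_bump l x \<ge> 0"
  unfolding sine_bump_def
proof (intro prod_nonneg ballI sin_ge_zero)
  fix j :: 3
  have b: "0 \<le> x $ j" "x $ j \<le> l $ j" using assms(2) by (auto simp: Omega_def mem_box_cart)
  show "0 \<le> pi * x $ j / l $ j" using b l[of j] by simp
  show "pi * x $ j / l $ j \<le> pi" using b l[of j] by (simp add: field_simps)
qed

lemma sine_bump_pos:
  assumes l: "\<And>j. l $ j > 0" and "x \<in> box 0 l"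
  shows "sine_bump l x > 0"
  unfolding sine_bump_def
proof (intro prod_pos sin_gt_zero)
  fix j :: 3
  have b: "0 < x $ j" "x $ j < l $ j" using assms(2) by (auto simp: mem_box_cart)
  show "0 < pi * x $ j / l $ j" using b l[of j] by simp
  show "pi * x $ j / l $ j < pi" using b l[of j] by (simp add: field_simps)
qed

lemma sine_bump_boundary:
  assumes l: "\<And>j. l $ j > 0" and "x $ j = 0 \<or> x $ j = l $ j"
  shows "sine_bump l x = 0"
proof -
  have "sin (pi * x $ j / l $ j) = 0" using assms(2) l[of j] by auto
  then show ?thesis unfolding sine_bump_def by (intro prod_zero) auto
qed

lemma sine_bump_le_1: "\<bar>sine_bump l x\<bar> \<le> 1"
  unfolding sine_bump_def abs_prod by (intro prod_le_1) auto

text \<open>Dominated convergence, with majorants |g| and 1, passes from the continuous cutoffs to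
  the indicator. Closed sets are what inner regularity asks for afterwards.\<close>

lemma fejer_closed_integral_le:
  assumes l: "\<And>j. l $ j > 0" and g: "integrable (boxm l) g"
    and bnd: "\<And>n x. (\<integral>y. fejer l n (x - y) * g y \<partial>boxm l) \<le> vol l * c"
    and T: "closed T"
  shows "(\<integral>x. g x * (indicator T x * sine_bump l x) \<partial>boxm l)
     \<le> c * (\<integral>x. indicator T x * sine_bump l x \<partial>boxm l)"
proof (cases "T = {}")
  case False
  interpret B: finite_measure "boxm l" by (rule finite_measure_boxm)
  define \<phi> where "\<phi> i x = max 0 (1 - real i * infdist x T) * sine_bump l x" for i x
  have phi_cont: "continuous_on UNIV (\<phi> i)" for i
    unfolding \<phi>_def by (intro continuous_intros continuous_sine_bump l)
  have phi_m[measurable]: "\<phi> i \<in> borel_measurable (boxm l)" for i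
    by (intro borel_measurable_boxm borel_measurable_continuous_onI phi_cont)
  have s_m[measurable]: "sine_bump l \<in> borel_measurable (boxm l)"
    by (intro borel_measurable_boxm borel_measurable_continuous_onI continuous_sine_bump l)
  have T_m[measurable]: "indicator T \<in> borel_measurable (boxm l)"
    using T by (intro borel_measurable_boxm borel_measurable_indicator) simp
  have g_m[measurable]: "g \<in> borel_measurable (boxm l)" using g by simp
  have lim: "(\<lambda>i. \<phi> i x) \<longlonglongrightarrow> indicator T x * sine_bump l x" for x
    unfolding \<phi>_def by (intro tendsto_intros bump_tendsto_indicator T False)
  have phi_le: "\<bar>\<phi> i x\<bar> \<le> 1" for i x
  proof -
    have "\<bar>max 0 (1 - real i * infdist x T)\<bar> \<le> 1" by (simp add: infdist_nonneg)
    then show ?thesis unfolding \<phi>_def abs_mult using sine_bump_le_1[of l x]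
      by (intro mult_le_one) auto
  qed
  have le: "(\<integral>x. g x * \<phi> i x \<partial>boxm l) \<le> c * (\<integral>x. \<phi> i x \<partial>boxm l)" for i
  proof (rule fejer_test_integral_le[OF l g bnd phi_cont])
    show "\<phi> i x = 0" if "x $ j = 0 \<or> x $ j = l $ j" for x j
      unfolding \<phi>_def using sine_bump_boundary[OF l that] by simp
    show "\<phi> i x \<ge> 0" if "x \<in> Omega l" for x
      unfolding \<phi>_def using sine_bump_nonneg[OF l that] by simp
  qed
  have "(\<lambda>i. \<integral>x. g x * \<phi> i x \<partial>boxm l) \<longlonglongrightarrow> (\<integral>x. g x * (indicator T x * sine_bump l x) \<partial>boxm l)"
  proof (rule integral_dominated_convergence)
    show "integrable (boxm l) (\<lambda>x. \<bar>g x\<bar>)" using g by simp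
    show "AE x in boxm l. (\<lambda>i. g x * \<phi> i x) \<longlonglongrightarrow> g x * (indicator T x * sine_bump l x)"
      by (intro AE_I2 tendsto_intros lim)
    show "AE x in boxm l. norm (g x * \<phi> i x) \<le> \<bar>g x\<bar>" for i
      using mult_left_mono[OF phi_le[of i] abs_ge_zero] by (auto simp: abs_mult)
  qed measurable
  moreover have "(\<lambda>i. c * (\<integral>x. \<phi> i x \<partial>boxm l)) \<longlonglongrightarrow> c * (\<integral>x. indicator T x * sine_bump l x \<partial>boxm l)"
  proof (intro tendsto_mult_left integral_dominated_convergence)
    show "integrable (boxm l) (\<lambda>x. 1 :: real)" by simp
    show "AE x in boxm l. (\<lambda>i. \<phi> i x) \<longlonglongrightarrow> indicator T x * sine_bump l x"
      by (intro AE_I2 lim)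
    show "AE x in boxm l. norm (\<phi> i x) \<le> 1" for i
      using phi_le by auto
  qed measurable
  ultimately show ?thesis using le by (intro LIMSEQ_le) auto
qed simp

text \<open>On a closed part T of the set where g > c, inside the open box, g - c times the weight
  is positive, yet its integral over T is at most 0; so T is null. Inner regularity extends this to
  the whole set, and the faces of the box are null.\<close>

lemma fejer_bound_imp_AE_le:
  assumes l: "\<And>j. l $ j > 0" and g: "integrable (boxm l) g"
    and bnd: "\<And>n x. (\<integral>y. fejer l n (x - y) * g y \<partial>boxm l) \<le> vol l * c"
  shows "AE x in boxm l. g x \<le> c"
proof -
  interpret B: finite_measure "boxm l" by (rule finite_measure_boxm)
  have g_m: "g \<in> borel_measurable (boxm l)" using g by simp
  \<comment> \<open>The open box, because the weight is strictly positive there and vanishes on the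
    faces.\<close>
  define X where "X = {x \<in> space (boxm l). c < g x} \<inter> box 0 l"
  have X_box: "X \<in> sets (boxm l)"
  proof -
    have "{x \<in> space (boxm l). c < g x} \<in> sets (boxm l)"
      by (rule borel_measurable_less[OF _ g_m]) simp
    moreover have "Omega l \<inter> box 0 l \<in> sets (boxm l)"
      by (simp add: sets_restrict_space_iff)
    moreover have "X = {x \<in> space (boxm l). c < g x} \<inter> (Omega l \<inter> box 0 l)"
      by (auto simp: X_def)
    ultimately show ?thesis by (simp only: sets.Int)
  qed
  then have X_borel: "X \<in> sets borel"
    by (simp add: sets_restrict_space_iff)
  have closed_null: "emeasure lborel T = 0" if T: "closed T" "T \<subseteq> X" for T
  proof -
    have TO: "T \<subseteq> Omega l" using T by (auto simp: X_def)
    let ?s = "\<lambda>x. indicator T x * sine_bump l x"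
    have T_m: "indicator T \<in> borel_measurable (boxm l)"
      using T by (intro borel_measurable_boxm borel_measurable_indicator) simp
    have s_m: "?s \<in> borel_measurable (boxm l)"
      by (intro borel_measurable_times T_m borel_measurable_boxm borel_measurable_continuous_onI
          continuous_sine_bump l)
    have s_le: "\<bar>?s x\<bar> \<le> 1" for x
      using sine_bump_le_1[of l x] by (auto simp: indicator_def)
    have i1: "integrable (boxm l) ?s"
      by (rule B.integrable_const_bound[OF _ s_m, of 1]) (intro AE_I2, simp only: real_norm_def s_le)
    have i2: "integrable (boxm l) (\<lambda>x. g x * ?s x)"
    proof -
      have "integrable (boxm l) (\<lambda>x. g x *\<^sub>R ?s x)"
        by (rule integrable_scaleR_bounded_right[OF g s_m, where B = 1]) (simp only: real_norm_def s_le)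
      then show ?thesis by (simp only: real_scaleR_def)
    qed
    have int: "integrable (boxm l) (\<lambda>x. g x * ?s x - c * ?s x)"
      by (intro Bochner_Integration.integrable_diff integrable_mult_right i1 i2)
    have nn: "0 \<le> g x * ?s x - c * ?s x" if "x \<in> Omega l" for x
    proof (cases "x \<in> T")
      case True
      then have "c \<le> g x" using T by (auto simp: X_def)
      then have "c * sine_bump l x \<le> g x * sine_bump l x"
        by (intro mult_right_mono sine_bump_nonneg l that)
      then show ?thesis using True by simp
    qed simp
    have "(\<integral>x. g x * ?s x - c * ?s x \<partial>boxm l) \<le> 0"
      using fejer_closed_integral_le[OF l g bnd T(1)]
      by (simp only: Bochner_Integration.integral_diff[OF i2 integrable_mult_right[OF i1]]
          integral_mult_right_zero diff_le_0_iff_le)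
    moreover have "(\<integral>x. g x * ?s x - c * ?s x \<partial>boxm l) \<ge> 0"
      by (intro integral_nonneg_AE AE_I2 nn) simp
    ultimately have "(\<integral>x. g x * ?s x - c * ?s x \<partial>boxm l) = 0" by simp
    moreover have "AE x in boxm l. 0 \<le> g x * ?s x - c * ?s x"
      by (intro AE_I2 nn) simp
    ultimately have "AE x in boxm l. g x * ?s x - c * ?s x = 0"
      using integral_nonneg_eq_0_iff_AE[OF int] by blast
    then have "AE x in boxm l. x \<notin> T"
    proof eventually_elim
      case (elim x)
      show ?case
      proof
        assume "x \<in> T"
        then have "x \<in> box 0 l" "c < g x" using T by (auto simp: X_def)
        then have "(g x - c) * sine_bump l x > 0" using sine_bump_pos[OF l] by simp
        moreover have "(g x - c) * sine_bump l x = 0"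
          unfolding left_diff_distrib using elim \<open>x \<in> T\<close>
          by (simp only: indicator_simps mult_1_left)
        ultimately show False by simp
      qed
    qed
    then have "AE x in lborel. x \<notin> T" unfolding AE_boxm by eventually_elim (use TO in blast)
    then have "T \<in> null_sets lborel" using T by (subst AE_iff_null_sets) auto
    then show ?thesis by (rule null_setsD1)
  qed
  have "emeasure lborel X = 0"
  proof (rule ccontr)
    assume ne: "emeasure lborel X \<noteq> 0"
    have fin: "emeasure lborel X < \<infinity>"
    proof -
      have "emeasure lborel X \<le> emeasure lborel (cbox 0 l)"
        by (intro emeasure_mono) (auto simp: X_def Omega_def)
      also have "\<dots> < \<infinity>" by (rule emeasure_lborel_cbox_finite)
      finally show ?thesis .
    qed
    have eq: "emeasure lborel X = ennreal (measure lborel X)"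
      using fin by (intro emeasure_eq_ennreal_measure) auto
    have "measure lborel X \<noteq> 0"
    proof
      assume "measure lborel X = 0"
      with eq have "emeasure lborel X = 0" by (simp only: ennreal_0)
      with ne show False ..
    qed
    then have pos: "measure lborel X > 0" using zero_less_measure_iff[of lborel X] by blast
    \<comment> \<open>The gap allowed in the approximation is the measure of \<open>X\<close>
      itself, so the closed subset cannot be null.\<close>
    have "X \<in> sets lebesgue" using X_borel by simp
    then obtain T where T: "closed T" "T \<subseteq> X" "X - T \<in> lmeasurable"
      "emeasure lebesgue (X - T) < ennreal (measure lborel X)"
      using pos by (rule sets_lebesgue_inner_closed)
    have TB: "T \<in> sets borel" using T(1) by simp
    have "emeasure lborel (T \<union> (X - T)) \<le> emeasure lborel T + emeasure lborel (X - T)"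
      using X_borel TB by (intro emeasure_subadditive) auto
    moreover have "T \<union> (X - T) = X" using T(2) by blast
    moreover have "emeasure lborel T = 0" by (rule closed_null[OF T(1,2)])
    moreover have "emeasure lborel (X - T) = emeasure lebesgue (X - T)"
      using X_borel TB by (subst emeasure_completion) auto
    ultimately have "emeasure lborel X \<le> emeasure lebesgue (X - T)" by (simp only: add_0)
    with T(4) show False unfolding eq[symmetric] using leD by blast
  qed
  then have "X \<in> null_sets lborel" using X_borel by auto
  then have "AE x in lborel. x \<notin> X" by (rule AE_not_in)
  moreover have "AE x in lborel. x \<notin> cbox 0 l - box 0 l"
  proof (rule AE_not_in)
    have "cbox 0 l - box 0 l \<in> null_sets lebesgue"
      using negligible_frontier_interval[of 0 l] by (simp add: negligible_iff_null_sets)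
    then show "cbox 0 l - box 0 l \<in> null_sets lborel"
      by (subst (asm) null_sets_completion_iff) auto
  qed
  ultimately have "AE x in lborel. x \<in> Omega l \<longrightarrow> g x \<le> c"
    by eventually_elim (auto simp: X_def Omega_def)
  then show ?thesis by (simp add: AE_boxm)
qed

text \<open>Both sides are continuous in E, so the inequality extends to all E, and E = A yields the
  norm. A dense set can be chosen countable, which keeps the union of the exceptional sets
  null.\<close>

lemma norm_le_if_dense_inner:
  fixes A :: rmat
  assumes D: "closure D = UNIV" and le: "\<And>E. E \<in> D \<Longrightarrow> A \<bullet> E \<le> c * norm E" and "c \<ge> 0"
  shows "norm A \<le> c"
proof -
  have "closed {E. A \<bullet> E \<le> c * norm E}"
    by (intro closed_Collect_le continuous_intros)
  then have "closure D \<subseteq> {E. A \<bullet> E \<le> c * norm E}"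
    using le by (intro closure_minimal) auto
  then have "A \<bullet> A \<le> c * norm A" using D by auto
  then have "norm A * norm A \<le> c * norm A" by (simp add: power2_norm_eq_inner[symmetric] power2_eq_square)
  then show ?thesis using \<open>c \<ge> 0\<close> by (cases "norm A = 0") auto
qed

text \<open>By Cauchy-Schwarz, the bound on the matrix-valued means gives a one-sided bound for the
  means of each component of \<open>f\<close> in a direction E, to which the scalar result
  applies.\<close>

lemma fejer_mean_bound_imp_AE_norm_le:
  assumes l: "\<And>j. l $ j > 0" and f: "integrable (boxm l) f"
    and bnd: "\<And>n x. norm (fejer_mean l n (mcoef l f) x) \<le> c"
  shows "AE x in boxm l. norm (f x) \<le> c"
proof -
  have V: "vol l > 0" by (rule vol_pos[OF l])
  have "c \<ge> 0" using bnd norm_ge_zero order_trans by blast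
  have "AE x in boxm l. f x \<bullet> E \<le> c * norm E" for E
  proof (rule fejer_bound_imp_AE_le[OF l])
    show "integrable (boxm l) (\<lambda>x. f x \<bullet> E)" using f by simp
    fix n x
    have "(\<integral>y. fejer l n (x - y) * (f y \<bullet> E) \<partial>boxm l) = (\<integral>y. fejer l n (x - y) *\<^sub>R f y \<partial>boxm l) \<bullet> E"
      by (subst integral_inner_left[symmetric]) (auto intro: integrable_fejer_scaleR[OF f])
    also have "\<dots> \<le> norm (\<integral>y. fejer l n (x - y) *\<^sub>R f y \<partial>boxm l) * norm E"
      by (rule norm_cauchy_schwarz)
    also have "\<dots> \<le> (vol l * c) * norm E"
    proof (intro mult_right_mono norm_ge_zero)
      show "norm (\<integral>y. fejer l n (x - y) *\<^sub>R f y \<partial>boxm l) \<le> vol l * c"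
        using bnd[of n x] V by (simp add: fejer_mean_mcoef[OF l f] norm_cplx divide_le_eq mult.commute)
    qed
    finally show "(\<integral>y. fejer l n (x - y) * (f y \<bullet> E) \<partial>boxm l) \<le> vol l * (c * norm E)"
      by (simp only: mult.assoc)
  qed
  moreover obtain D :: "rmat set" where D: "countable D" "closure D = UNIV"
  proof -
    obtain D :: "rmat set" where D: "countable D" "\<And>X. open X \<Longrightarrow> X \<noteq> {} \<Longrightarrow> \<exists>d\<in>D. d \<in> X"
      using countable_dense_setE by blast
    have "- closure D = {}"
    proof (rule ccontr)
      assume "- closure D \<noteq> {}"
      then obtain d where "d \<in> D" "d \<in> - closure D" using D(2)[of "- closure D"] by auto
      then show False using closure_subset[of D] by auto
    qed
    then show ?thesis using that[OF D(1)] by auto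
  qed
  ultimately have "AE x in boxm l. \<forall>E\<in>D. f x \<bullet> E \<le> c * norm E"
    by (subst AE_ball_countable) auto
  then show ?thesis
    by eventually_elim (use norm_le_if_dense_inner[OF D(2) _ \<open>c \<ge> 0\<close>] in blast)
qed

section \<open>Symmetry seen through Fourier coefficients\<close>

lemma integrable_transpose:
  assumes "integrable M (f :: 'a \<Rightarrow> rmat)"
  shows "integrable M (\<lambda>x. transpose (f x))"
  using integrable_bounded_linear[OF bounded_linear_mat_nth assms]
  by (intro integrable_matI) (simp add: transpose_def)

lemma integrable_wave:
  assumes "integrable (boxm l) (g :: real^3 \<Rightarrow> real)"
  shows "integrable (boxm l) (\<lambda>x. complex_of_real (g x) * exp (- \<i> * complex_of_real (wavevec l k \<bullet> x)))"
proof -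
  have "(\<lambda>x. exp (- \<i> * complex_of_real (wavevec l k \<bullet> x))) \<in> borel_measurable (boxm l)"
    by (intro borel_measurable_boxm borel_measurable_continuous_onI continuous_intros)
  moreover have "norm (exp (- \<i> * complex_of_real (wavevec l k \<bullet> x))) \<le> 1" for x
    by simp
  ultimately have "integrable (boxm l) (\<lambda>x. g x *\<^sub>R exp (- \<i> * complex_of_real (wavevec l k \<bullet> x)))"
    by (rule integrable_scaleR_bounded_right[OF assms])
  then show ?thesis by (simp only: scaleR_conv_of_real)
qed

lemma mcoef_symmetric:
  assumes "integrable (boxm l) f" "AE x in boxm l. transpose (f x) = f x"
  shows "transpose (mcoef l f k) = mcoef l f k"
proof -
  have m: "(\<lambda>x. complex_of_real (f x $ i $ j) * exp (- \<i> * complex_of_real (wavevec l k \<bullet> x)))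
      \<in> borel_measurable (boxm l)" for i j
    by (intro borel_measurable_integrable integrable_wave
        integrable_bounded_linear[OF bounded_linear_mat_nth assms(1)])
  have "fcoef l (\<lambda>x. complex_of_real (f x $ i $ j)) k = fcoef l (\<lambda>x. complex_of_real (f x $ j $ i)) k" for i j
  proof -
    have ae: "AE x in boxm l. complex_of_real (f x $ i $ j) * exp (- \<i> * complex_of_real (wavevec l k \<bullet> x))
       = complex_of_real (f x $ j $ i) * exp (- \<i> * complex_of_real (wavevec l k \<bullet> x))"
      using assms(2)
    proof eventually_elim
      case (elim x)
      then have "transpose (f x) $ j $ i = f x $ j $ i" by simp
      then show ?case by (simp add: transpose_def)
    qed
    show ?thesis
      unfolding fcoef_def set_integral_boxm using integral_cong_AE[OF m m ae] by simp
  qed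
  then show ?thesis by (simp add: vec_eq_iff transpose_def mcoef_def)
qed

lemma AE_symmetric_if_mcoef:
  assumes l: "\<And>j. l $ j > 0" and f: "integrable (boxm l) f"
    and sym: "\<And>k. transpose (mcoef l f k) = mcoef l f k"
  shows "AE x in boxm l. transpose (f x) = f x"
proof -
  define h where "h x = f x - transpose (f x)" for x
  have h: "integrable (boxm l) h"
    unfolding h_def by (intro Bochner_Integration.integrable_diff integrable_transpose f)
  note fij = integrable_bounded_linear[OF bounded_linear_mat_nth f]
  have "mcoef l h k = 0" for k
  proof -
    have "mcoef l h k $ i $ j = mcoef l f k $ i $ j - mcoef l f k $ j $ i" for i j
      using integrable_wave[OF fij, of i j k] integrable_wave[OF fij, of j i k]
      by (simp add: mcoef_def fcoef_def set_integral_boxm h_def transpose_def left_diff_distrib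
          diff_divide_distrib)
    moreover have "mcoef l f k $ j $ i = mcoef l f k $ i $ j" for i j
      using sym[of k] by (simp add: vec_eq_iff transpose_def)
    ultimately show ?thesis by (simp add: vec_eq_iff)
  qed
  then have "norm (fejer_mean l n (mcoef l h) x) \<le> 0" for n x
    by (simp add: fejer_mean_def cscale.zero_right)
  from fejer_mean_bound_imp_AE_norm_le[OF l h this]
  show ?thesis by eventually_elim (simp add: h_def)
qed

section \<open>The nonlinearity\<close>

lemma symmetric_nth:
  assumes "transpose A = A"
  shows "A $ i $ j = A $ j $ i"
proof -
  have "transpose A $ j $ i = A $ j $ i" using assms by simp
  then show ?thesis by (simp add: transpose_def)
qed

lemma transpose_Nop:
  assumes "transpose A = A"
  shows "transpose (Nop \<kappa>1 \<kappa>2 \<alpha> \<beta> \<gamma> A) = Nop \<kappa>1 \<kappa>2 \<alpha> \<beta> \<gamma> A"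
proof -
  have s: "A $ i $ j = A $ j $ i" for i j
    by (rule symmetric_nth[OF assms])
  have "(A ** A) $ j $ i = (A ** A) $ i $ j" for i j
  proof -
    have "A $ j $ k * A $ k $ i = A $ i $ k * A $ k $ j" for k
      by (subst (1 2) s) (rule mult.commute)
    then show ?thesis by (simp add: matrix_matrix_mult_def)
  qed
  moreover have "(mat 1 :: rmat) $ j $ i = mat 1 $ i $ j" for i j by (simp add: mat_def)
  moreover have "transpose (Nop \<kappa>1 \<kappa>2 \<alpha> \<beta> \<gamma> A) $ i $ j = Nop \<kappa>1 \<kappa>2 \<alpha> \<beta> \<gamma> A $ j $ i" for i j
    by (simp add: transpose_def)
  ultimately show ?thesis
    unfolding vec_eq_iff by (simp add: Nop_def fbulk_def) (metis s)
qed

lemma trace_square_symmetric: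
  assumes "transpose (A::rmat) = A"
  shows "trace (A ** A) = (norm A)\<^sup>2"
proof -
  have s: "A $ i $ j = A $ j $ i" for i j
    by (rule symmetric_nth[OF assms])
  have "A $ i $ j * A $ j $ i = (A $ i $ j)\<^sup>2" for i j
    unfolding s[of j i] by (simp add: power2_eq_square)
  then show ?thesis
    by (simp add: trace_def matrix_matrix_mult_def norm_sq_rmat)
qed

text \<open>For symmetric A the entries of A^2 are the inner products of the rows of A.
  Cauchy-Schwarz bounds each of them, and the resulting double sum is a perfect square.\<close>

lemma norm_matrix_square_le:
  assumes "transpose (A::rmat) = A"
  shows "norm (A ** A) \<le> (norm A)\<^sup>2"
proof -
  have s: "A $ i $ j = A $ j $ i" for i j
    by (rule symmetric_nth[OF assms])
  have r: "(A ** A) $ i $ j = A $ i \<bullet> A $ j" for i j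
    unfolding matrix_matrix_mult_def inner_vec_def
    by (auto intro!: sum.cong arg_cong[of _ _ "\<lambda>x. _ * x"] s)
  have n: "(norm A)\<^sup>2 = (\<Sum>i\<in>UNIV. (norm (A $ i))\<^sup>2)"
    by (simp add: power2_norm_eq_inner inner_vec_def[of A])
  have "(norm (A ** A))\<^sup>2 = (\<Sum>i\<in>UNIV. \<Sum>j\<in>UNIV. (A $ i \<bullet> A $ j)\<^sup>2)"
    by (simp add: norm_sq_rmat r)
  also have "\<dots> \<le> (\<Sum>i\<in>UNIV. \<Sum>j\<in>UNIV. (norm (A $ i))\<^sup>2 * (norm (A $ j))\<^sup>2)"
    by (intro sum_mono) (simp add: power2_norm_eq_inner Cauchy_Schwarz_ineq)
  also have "\<dots> = ((norm A)\<^sup>2)\<^sup>2"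
    unfolding n power2_eq_square[of "sum _ _"] sum_product ..
  finally show ?thesis by (rule power2_le_imp_le) simp
qed

text \<open>Removing the trace part is the orthogonal projection off the identity matrix, whose
  squared norm is 3.\<close>

lemma norm_deviator_le: "norm (B - (trace B / 3) *\<^sub>R mat 1) \<le> norm (B :: rmat)"
proof -
  have t: "B \<bullet> mat 1 = trace B"
    by (simp add: inner_vec_def trace_def mat_def sum_3)
  have m: "(mat 1 :: rmat) \<bullet> mat 1 = 3"
    by (simp add: inner_vec_def mat_def sum_3)
  have "(norm (B - (trace B / 3) *\<^sub>R mat 1))\<^sup>2 = (norm B)\<^sup>2 - (trace B)\<^sup>2 / 3"
    unfolding power2_norm_eq_inner inner_diff_left inner_diff_right inner_scaleR_left
      inner_scaleR_right t m inner_commute[of "mat 1" B]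
    by (simp add: power2_eq_square)
  also have "\<dots> \<le> (norm B)\<^sup>2" by simp
  finally show ?thesis by (rule power2_le_imp_le) simp
qed

text \<open>Here q stands for the norm of the matrix. Young's inequality for |\<beta>| q produces
  the factor \<kappa>1 + \<gamma>/2 (b - q^2), which is the origin of \<open>b\<close>. For q^2
  \<ge> b the reaction only lowers \<kappa>1 q; for smaller q the surplus has to be paid for by
  \<kappa>1 (a - q), and this is where the quadratic lower bound on \<kappa>1 is spent.\<close>

lemma reaction_bound:
  fixes q a b \<alpha> \<beta> \<gamma> \<kappa>1 \<kappa>2 :: real
  assumes "0 \<le> q" "q \<le> a" "a > 0" "\<gamma> > 0" "\<kappa>2 \<ge> 0" and b: "b = \<beta>\<^sup>2 / \<gamma>\<^sup>2 - 2 * (\<alpha> - \<kappa>2) / \<gamma>" "b < a\<^sup>2"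
    and \<kappa>1: "\<kappa>1 \<ge> (\<kappa>2 + (\<bar>\<alpha>\<bar> + \<bar>\<beta>\<bar> * a + \<gamma> * a\<^sup>2 + \<gamma> * \<bar>b\<bar>))\<^sup>2 / (\<gamma> * (a\<^sup>2 - b))"
  shows "\<bar>\<kappa>1 + \<kappa>2 - \<alpha> - \<gamma> * q\<^sup>2\<bar> * q + \<bar>\<beta>\<bar> * q\<^sup>2 \<le> \<kappa>1 * a"
proof -
  define K where "K = \<kappa>2 + (\<bar>\<alpha>\<bar> + \<bar>\<beta>\<bar> * a + \<gamma> * a\<^sup>2 + \<gamma> * \<bar>b\<bar>)"
  have ba: "\<bar>\<beta>\<bar> * a \<ge> 0" "\<gamma> * a\<^sup>2 \<ge> 0" "\<gamma> * \<bar>b\<bar> \<ge> 0" using assms by auto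
  have q2: "q\<^sup>2 \<le> a\<^sup>2" using assms by (intro power_mono) auto
  have x0: "a\<^sup>2 - b > 0" using b by simp
  have den: "\<gamma> * (a\<^sup>2 - b) > 0" using x0 assms by simp
  have K2: "\<kappa>1 * (\<gamma> * (a\<^sup>2 - b)) \<ge> K\<^sup>2"
    using \<kappa>1 den unfolding K_def[symmetric] by (simp add: pos_divide_le_eq)
  have Kden: "\<gamma> * (a\<^sup>2 - b) \<le> K"
  proof -
    have "\<gamma> * (a\<^sup>2 - b) \<le> \<gamma> * (a\<^sup>2 + \<bar>b\<bar>)" using assms(4) by (intro mult_left_mono) auto
    also have "\<dots> \<le> K" using ba assms(5) by (simp add: K_def distrib_left)
    finally show ?thesis .
  qed
  have K0: "K > 0" using Kden den by linarith
  have KK: "\<kappa>1 \<ge> K"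
  proof -
    have "K * (\<gamma> * (a\<^sup>2 - b)) \<le> K * K" using Kden K0 by (intro mult_left_mono) auto
    also have "\<dots> \<le> \<kappa>1 * (\<gamma> * (a\<^sup>2 - b))" using K2 by (simp add: power2_eq_square)
    finally show ?thesis using den by (rule mult_right_le_imp_le)
  qed
  have gq: "\<gamma> * q\<^sup>2 \<le> \<gamma> * a\<^sup>2" using q2 assms(4) by (intro mult_left_mono) auto
  have c0: "\<kappa>1 + \<kappa>2 - \<alpha> - \<gamma> * q\<^sup>2 \<ge> 0"
    using KK gq ba assms(5) unfolding K_def by linarith
  have "\<bar>\<beta>\<bar> * q \<le> \<gamma> * q\<^sup>2 / 2 + \<beta>\<^sup>2 / (2 * \<gamma>)"
  proof -
    have "0 \<le> (\<gamma> * q - \<bar>\<beta>\<bar>)\<^sup>2 / (2 * \<gamma>)" using assms(4) by simp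
    also have "\<dots> = \<gamma> * q\<^sup>2 / 2 + \<beta>\<^sup>2 / (2 * \<gamma>) - \<bar>\<beta>\<bar> * q"
      using assms(4) by (simp add: power2_diff field_simps power2_eq_square)
    finally show ?thesis by simp
  qed
  moreover have "\<gamma> / 2 * b = \<beta>\<^sup>2 / (2 * \<gamma>) - (\<alpha> - \<kappa>2)"
    using assms(4) unfolding b(1) by (simp add: field_simps power2_eq_square)
  ultimately have "\<kappa>1 + \<kappa>2 - \<alpha> - \<gamma> * q\<^sup>2 + \<bar>\<beta>\<bar> * q \<le> \<kappa>1 + \<gamma> / 2 * (b - q\<^sup>2)"
    by (simp add: algebra_simps)
  then have "(\<kappa>1 + \<kappa>2 - \<alpha> - \<gamma> * q\<^sup>2 + \<bar>\<beta>\<bar> * q) * q \<le> (\<kappa>1 + \<gamma> / 2 * (b - q\<^sup>2)) * q"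
    using assms(1) by (rule mult_right_mono)
  also have "\<dots> \<le> \<kappa>1 * a"
  proof (cases "q\<^sup>2 \<ge> b")
    case True
    then have "\<gamma> / 2 * (b - q\<^sup>2) \<le> 0" using assms(4) by (intro mult_nonneg_nonpos) auto
    then have "(\<kappa>1 + \<gamma> / 2 * (b - q\<^sup>2)) * q \<le> \<kappa>1 * q" using assms(1) by (intro mult_right_mono) auto
    also have "\<dots> \<le> \<kappa>1 * a" using assms(2) KK K0 by (intro mult_left_mono) auto
    finally show ?thesis .
  next
    case False
    \<comment> \<open>Now x + y = (a - q) (a + q), and the hypothesis on \<kappa>1 reads \<kappa>1
      \<gamma> x \<ge> K^2. Multiplying the target \<gamma> a q y \<le> \<kappa>1 (x + y) by
      \<gamma> x reduces it to an upper bound for x y.\<close>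
    define x where "x = a\<^sup>2 - b"
    define y where "y = b - q\<^sup>2"
    have xy: "x > 0" "y > 0" "x + y = a\<^sup>2 - q\<^sup>2" using x0 False by (auto simp: x_def y_def)
    have K1: "\<kappa>1 * (\<gamma> * x) \<ge> K\<^sup>2" using K2 by (simp add: x_def)
    have 1: "\<gamma>\<^sup>2 * (a * q) * (x * y) \<le> K\<^sup>2 * (x + y)"
    proof -
      have "4 * (x * y) \<le> (x + y)\<^sup>2"
        using zero_le_power2[of "x - y"] by (simp add: power2_eq_square algebra_simps)
      also have "\<dots> \<le> a\<^sup>2 * (x + y)"
        unfolding power2_eq_square[of "x + y"] using xy by (intro mult_right_mono) auto
      finally have p: "x * y \<le> a\<^sup>2 * (x + y)" using mult_pos_pos[OF xy(1,2)] by linarith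
      have "\<gamma>\<^sup>2 * (a * q) * (x * y) \<le> \<gamma>\<^sup>2 * (a * a) * (a\<^sup>2 * (x + y))"
      proof (rule mult_mono[OF _ p])
        show "\<gamma>\<^sup>2 * (a * q) \<le> \<gamma>\<^sup>2 * (a * a)" using assms(2,3) by (intro mult_left_mono) auto
        show "0 \<le> \<gamma>\<^sup>2 * (a * a)" "0 \<le> x * y" using xy by auto
      qed
      also have "\<dots> = (\<gamma> * a\<^sup>2)\<^sup>2 * (x + y)" by (simp add: power2_eq_square)
      also have "\<dots> \<le> K\<^sup>2 * (x + y)"
        using xy ba assms(5) by (intro mult_right_mono power_mono) (auto simp: K_def)
      finally show ?thesis .
    qed
    have "(\<gamma> * x) * (\<gamma> * (a * q) * y) \<le> (\<gamma> * x) * (\<kappa>1 * (x + y))"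
    proof -
      have "(\<gamma> * x) * (\<gamma> * (a * q) * y) = \<gamma>\<^sup>2 * (a * q) * (x * y)" by (simp add: power2_eq_square)
      also have "\<dots> \<le> K\<^sup>2 * (x + y)" by (rule 1)
      also have "\<dots> \<le> \<kappa>1 * (\<gamma> * x) * (x + y)" using K1 xy by (intro mult_right_mono) auto
      finally show ?thesis by (simp add: mult_ac)
    qed
    then have "\<gamma> * (a * q) * y \<le> \<kappa>1 * (x + y)"
      using xy assms(4) by (simp add: mult_le_cancel_left_pos)
    also have "\<kappa>1 * (x + y) = \<kappa>1 * (a - q) * (a + q)"
      unfolding xy(3) by (simp add: power2_eq_square algebra_simps)
    \<comment> \<open>Replacing a + q by 2 a leaves a common factor \<open>a\<close> to
      cancel.\<close>
    also have "\<dots> \<le> \<kappa>1 * (a - q) * (2 * a)"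
      using assms(1,2) KK K0 by (intro mult_left_mono) auto
    finally have "a * (\<gamma> / 2 * y * q) \<le> a * (\<kappa>1 * (a - q))" by (simp add: algebra_simps)
    then have "\<gamma> / 2 * y * q \<le> \<kappa>1 * (a - q)" using assms(3) by (rule mult_left_le_imp_le)
    then show ?thesis by (simp add: y_def algebra_simps)
  qed
  finally show ?thesis using c0 by (simp add: algebra_simps power2_eq_square)
qed

lemma norm_Nop_le:
  assumes A: "transpose A = A" "norm A \<le> a" and "a > 0" "\<gamma> > 0" "\<kappa>2 \<ge> 0"
    and "b = \<beta>\<^sup>2 / \<gamma>\<^sup>2 - 2 * (\<alpha> - \<kappa>2) / \<gamma>" "b < a\<^sup>2"
    and "\<kappa>1 \<ge> (\<kappa>2 + (\<bar>\<alpha>\<bar> + \<bar>\<beta>\<bar> * a + \<gamma> * a\<^sup>2 + \<gamma> * \<bar>b\<bar>))\<^sup>2 / (\<gamma> * (a\<^sup>2 - b))"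
  shows "norm (Nop \<kappa>1 \<kappa>2 \<alpha> \<beta> \<gamma> A) \<le> \<kappa>1 * a"
proof -
  let ?q = "norm A"
  let ?B = "A ** A - (trace (A ** A) / 3) *\<^sub>R mat 1"
  have "Nop \<kappa>1 \<kappa>2 \<alpha> \<beta> \<gamma> A = (\<kappa>1 + \<kappa>2 - \<alpha> - \<gamma> * ?q\<^sup>2) *\<^sub>R A + \<beta> *\<^sub>R ?B"
    by (simp add: Nop_def fbulk_def trace_square_symmetric[OF A(1)] algebra_simps)
  then have "norm (Nop \<kappa>1 \<kappa>2 \<alpha> \<beta> \<gamma> A) \<le> \<bar>\<kappa>1 + \<kappa>2 - \<alpha> - \<gamma> * ?q\<^sup>2\<bar> * ?q + \<bar>\<beta>\<bar> * norm ?B"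
    by (simp only: norm_scaleR[symmetric] norm_triangle_ineq)
  also have "\<dots> \<le> \<bar>\<kappa>1 + \<kappa>2 - \<alpha> - \<gamma> * ?q\<^sup>2\<bar> * ?q + \<bar>\<beta>\<bar> * ?q\<^sup>2"
    using order_trans[OF norm_deviator_le norm_matrix_square_le[OF A(1)]]
    by (intro add_left_mono mult_left_mono) auto
  also have "\<dots> \<le> \<kappa>1 * a"
    by (rule reaction_bound[OF norm_ge_zero assms(2-8)])
  finally show ?thesis .
qed

section \<open>The exponential integrators\<close>

lemma fejer_mean_add: "fejer_mean l n (\<lambda>k. A k + B k) x = fejer_mean l n A x + fejer_mean l n B x"
  unfolding fejer_mean_def by (simp only: scaleR_add_right cscale.add_right sum.distrib)

lemma fejer_mean_scaleR: "fejer_mean l n (\<lambda>k. c *\<^sub>R A k) x = c *\<^sub>R fejer_mean l n A x"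
  unfolding fejer_mean_def scaleR_sum_right
  by (simp only: cscale.scaleR_right scaleR_left_commute)

lemma fejer_mean_has_integral:
  assumes "\<And>k. ((\<lambda>s. A s k) has_integral I k) S"
  shows "((\<lambda>s. fejer_mean l n (A s) x) has_integral fejer_mean l n I x) S"
  unfolding fejer_mean_def
proof (intro has_integral_sum finite_cartesian_product finite_freqs)
  fix i
  show "((\<lambda>s. cscale (cis (wavevec l (fst i - snd i) \<bullet> x)) ((1 / real (card (freqs n))) *\<^sub>R A s (fst i - snd i)))
     has_integral cscale (cis (wavevec l (fst i - snd i) \<bullet> x)) ((1 / real (card (freqs n))) *\<^sub>R I (fst i - snd i))) S"
    using has_integral_linear[OF has_integral_cmul[OF assms] cscale.bounded_linear_right]
    by (simp add: o_def)
qed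

text \<open>The weight 1 / card moves inside the real-linear exponential, which gives the mean the
  shape of a plain trigonometric sum.\<close>

lemma fejer_mean_contraction:
  assumes l: "\<And>j. l $ j > 0" and L: "L1 > 0" "\<kappa>2 \<ge> L4\<^sup>2 / (2 * L1)"
    and sym: "\<And>k. transpose (A k) = A k"
    and bnd: "\<And>x. norm (fejer_mean l n A x) \<le> c" and "t \<ge> 0"
  shows "norm (fejer_mean l n (\<lambda>k. expop t (Lsym L1 L4 \<kappa>1 \<kappa>2 (wavevec l k)) (A k)) x) \<le> exp (- \<kappa>1 * t) * c"
proof -
  have "(1 / real (card (freqs n))) *\<^sub>R expop t (Lsym L1 L4 \<kappa>1 \<kappa>2 (wavevec l k)) (A k)
      = expop t (Lsym L1 L4 \<kappa>1 \<kappa>2 (wavevec l k)) ((1 / real (card (freqs n))) *\<^sub>R A k)" for k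
    by (simp only: linear_scale[OF linear_expop[OF linear_Lsym]])
  moreover have "transpose ((1 / real (card (freqs n))) *\<^sub>R A k) = (1 / real (card (freqs n))) *\<^sub>R A k" for k
    by (simp only: linear_scale[OF linear_transpose_cmat] sym)
  ultimately show ?thesis
    unfolding fejer_mean_def
    using trig_sum_contraction[OF l _ L, where I = "freqs n \<times> freqs n" and k = "\<lambda>i. fst i - snd i"
        and A = "\<lambda>i. (1 / real (card (freqs n))) *\<^sub>R A (fst i - snd i)" and c = c and t = t]
      bnd[unfolded fejer_mean_def] \<open>t \<ge> 0\<close>
    by (simp only: finite_cartesian_product finite_freqs simp_thms)
qed

text \<open>The invariant of the time stepping. Symmetry travels with the bound because the
  contraction and the estimate of the nonlinearity both rest on it.\<close>

definition bounded_sym :: "real^3 \<Rightarrow> real \<Rightarrow> (real^3 \<Rightarrow> rmat) \<Rightarrow> bool" where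
  "bounded_sym l c f \<longleftrightarrow> integrable (boxm l) f \<and> (AE x in boxm l. transpose (f x) = f x)
     \<and> (AE x in boxm l. norm (f x) \<le> c)"

text \<open>The weights 1 - s / \<tau> and s / \<tau> form a convex combination, so interpolation
  keeps the bound \<kappa>1 a of the two nonlinear terms. \<open>Qn\<close> enters as an integrable
  function; its symmetry is read off its coefficients and its bound off its Fejer means.\<close>

lemma etdrk2_step_preserves:
  assumes l: "\<And>j. l $ j > 0" and L: "L1 > 0" "\<kappa>2 \<ge> L4\<^sup>2 / (2 * L1)" and "\<tau> > 0"
    and Qm: "bounded_sym l a Qm"
    and Nm: "bounded_sym l (\<kappa>1 * a) (\<lambda>x. Nop \<kappa>1 \<kappa>2 \<alpha> \<beta> \<gamma> (Qm x))"
    and Nt: "bounded_sym l (\<kappa>1 * a) (\<lambda>x. Nop \<kappa>1 \<kappa>2 \<alpha> \<beta> \<gamma> (Qt x))"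
    and Qn: "integrable (boxm l) Qn"
    and step: "etdrk2_step l L1 L4 \<kappa>1 \<kappa>2 \<alpha> \<beta> \<gamma> \<tau> Qm Qt Qn"
  shows "bounded_sym l a Qn"
proof -
  define A where "A = mcoef l Qm"
  define X where "X = mcoef l (\<lambda>x. Nop \<kappa>1 \<kappa>2 \<alpha> \<beta> \<gamma> (Qm x))"
  define Y where "Y = mcoef l (\<lambda>x. Nop \<kappa>1 \<kappa>2 \<alpha> \<beta> \<gamma> (Qt x))"
  define M where "M k = Lsym L1 L4 \<kappa>1 \<kappa>2 (wavevec l k)" for k
  define F where "F s k = (1 - s / \<tau>) *\<^sub>R X k + (s / \<tau>) *\<^sub>R Y k" for s k
  have linM: "linear (M k)" for k unfolding M_def by (rule linear_Lsym)
  have symM: "transpose (expop t (M k) Z) = expop t (M k) Z" if "transpose Z = Z" for t k Z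
    by (rule expop_symmetric[OF linM _ that]) (simp only: M_def Lsym_symmetric)
  have symA: "transpose (A k) = A k" for k
    unfolding A_def using Qm by (intro mcoef_symmetric) (auto simp: bounded_sym_def)
  have symX: "transpose (X k) = X k" for k
    unfolding X_def using Nm by (intro mcoef_symmetric) (auto simp: bounded_sym_def)
  have symY: "transpose (Y k) = Y k" for k
    unfolding Y_def using Nt by (intro mcoef_symmetric) (auto simp: bounded_sym_def)
  have symF: "transpose (F s k) = F s k" for s k
    unfolding F_def
    by (simp only: linear_add[OF linear_transpose_cmat] linear_scale[OF linear_transpose_cmat] symX symY)
  have bA: "norm (fejer_mean l n A x) \<le> a" for n x
    unfolding A_def using Qm by (intro norm_fejer_mean_le l) (auto simp: bounded_sym_def)
  have bX: "norm (fejer_mean l n X x) \<le> \<kappa>1 * a" for n x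
    unfolding X_def using Nm by (intro norm_fejer_mean_le l) (auto simp: bounded_sym_def)
  have bY: "norm (fejer_mean l n Y x) \<le> \<kappa>1 * a" for n x
    unfolding Y_def using Nt by (intro norm_fejer_mean_le l) (auto simp: bounded_sym_def)
  have bF: "norm (fejer_mean l n (F s) x) \<le> \<kappa>1 * a" if "s \<in> {0..\<tau>}" for s n x
  proof -
    have s: "0 \<le> s / \<tau>" "0 \<le> 1 - s / \<tau>" using that \<open>\<tau> > 0\<close> by auto
    have "norm (fejer_mean l n (F s) x)
        \<le> (1 - s / \<tau>) * norm (fejer_mean l n X x) + (s / \<tau>) * norm (fejer_mean l n Y x)"
      unfolding F_def fejer_mean_add fejer_mean_scaleR
      using norm_triangle_ineq[of "(1 - s / \<tau>) *\<^sub>R fejer_mean l n X x" "(s / \<tau>) *\<^sub>R fejer_mean l n Y x"]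
      by (simp only: norm_scaleR abs_of_nonneg[OF s(1)] abs_of_nonneg[OF s(2)])
    also have "\<dots> \<le> (1 - s / \<tau>) * (\<kappa>1 * a) + (s / \<tau>) * (\<kappa>1 * a)"
      using s by (intro add_mono mult_left_mono bX bY)
    also have "\<dots> = \<kappa>1 * a" by (simp add: algebra_simps)
    finally show ?thesis .
  qed
  define J where "J k = integral {0..\<tau>} (\<lambda>s. expop (\<tau> - s) (M k) (F s k))" for k
  \<comment> \<open>Existence has to be proved, since \<open>integral\<close> is 0 by default; only
    a genuine integral commutes with transposition and with Fejer means.\<close>
  have J: "((\<lambda>s. expop (\<tau> - s) (M k) (F s k)) has_integral J k) {0..\<tau>}" for k
  proof -
    have e: "expop (\<tau> - s) (M k) (F s k)
        = (1 - s / \<tau>) *\<^sub>R expop (\<tau> - s) (M k) (X k) + (s / \<tau>) *\<^sub>R expop (\<tau> - s) (M k) (Y k)" for s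
      unfolding F_def
      by (simp only: linear_add[OF linear_expop[OF linM]] linear_scale[OF linear_expop[OF linM]])
    have c: "continuous_on {0..\<tau>} (\<lambda>s. expop (\<tau> - s) (M k) Z)" for Z
      by (rule continuous_on_compose2[OF continuous_on_expop[OF linM, of UNIV]])
        (auto intro!: continuous_intros)
    have "continuous_on {0..\<tau>} (\<lambda>s. expop (\<tau> - s) (M k) (F s k))"
      unfolding e using \<open>\<tau> > 0\<close> by (intro continuous_intros c) auto
    then show ?thesis unfolding J_def by (intro integrable_integral integrable_continuous_real)
  qed
  have cn: "mcoef l Qn k = expop \<tau> (M k) (A k) + J k" for k
    using step unfolding etdrk2_step_def A_def X_def Y_def M_def F_def J_def by blast
  have "transpose (J k) = J k" for k
  proof -
    have "((\<lambda>s. transpose (expop (\<tau> - s) (M k) (F s k))) has_integral transpose (J k)) {0..\<tau>}"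
      using has_integral_linear[OF J linear_conv_bounded_linear[THEN iffD1, OF linear_transpose_cmat]]
      by (simp only: o_def)
    then have "((\<lambda>s. expop (\<tau> - s) (M k) (F s k)) has_integral transpose (J k)) {0..\<tau>}"
      by (simp only: symM[OF symF])
    then show ?thesis using J by (rule has_integral_unique)
  qed
  then have "transpose (mcoef l Qn k) = mcoef l Qn k" for k
    unfolding cn by (simp only: linear_add[OF linear_transpose_cmat] symM[OF symA])
  then have symn: "AE x in boxm l. transpose (Qn x) = Qn x"
    by (rule AE_symmetric_if_mcoef[OF l Qn])
  have "norm (fejer_mean l n (mcoef l Qn) x) \<le> a" for n x
  proof -
    \<comment> \<open>Keeping the factor \<kappa>1 gives the antiderivative exp (- \<kappa>1 (\<tau>
      - s)) a without dividing by \<kappa>1.\<close>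
    define g where "g s = exp (- \<kappa>1 * (\<tau> - s)) * (\<kappa>1 * a)" for s
    have I: "((\<lambda>s. fejer_mean l n (\<lambda>k. expop (\<tau> - s) (M k) (F s k)) x) has_integral fejer_mean l n J x) {0..\<tau>}"
      by (rule fejer_mean_has_integral[OF J])
    have "(g has_integral (exp (- \<kappa>1 * (\<tau> - \<tau>)) * a - exp (- \<kappa>1 * (\<tau> - 0)) * a)) {0..\<tau>}"
    proof (rule fundamental_theorem_of_calculus)
      show "0 \<le> \<tau>" using \<open>\<tau> > 0\<close> by simp
      show "((\<lambda>s. exp (- \<kappa>1 * (\<tau> - s)) * a) has_vector_derivative g s) (at s within {0..\<tau>})" for s
        unfolding g_def has_real_derivative_iff_has_vector_derivative[symmetric]
        by (auto intro!: derivative_eq_intros)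
    qed
    then have g: "(g has_integral (a - exp (- \<kappa>1 * \<tau>) * a)) {0..\<tau>}" by simp
    have "norm (integral {0..\<tau>} (\<lambda>s. fejer_mean l n (\<lambda>k. expop (\<tau> - s) (M k) (F s k)) x)) \<le> integral {0..\<tau>} g"
    proof (rule integral_norm_bound_integral)
      show "(\<lambda>s. fejer_mean l n (\<lambda>k. expop (\<tau> - s) (M k) (F s k)) x) integrable_on {0..\<tau>}"
        "g integrable_on {0..\<tau>}" using I g by (auto intro: has_integral_integrable)
      fix s assume s: "s \<in> {0..\<tau>}"
      show "norm (fejer_mean l n (\<lambda>k. expop (\<tau> - s) (M k) (F s k)) x) \<le> g s"
        unfolding g_def M_def
        by (rule fejer_mean_contraction[OF l L symF bF[OF s]]) (use s in simp)
    qed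
    then have "norm (fejer_mean l n J x) \<le> a - exp (- \<kappa>1 * \<tau>) * a"
      by (simp only: integral_unique[OF I] integral_unique[OF g])
    moreover have "norm (fejer_mean l n (\<lambda>k. expop \<tau> (M k) (A k)) x) \<le> exp (- \<kappa>1 * \<tau>) * a"
      unfolding M_def using \<open>\<tau> > 0\<close> by (intro fejer_mean_contraction[OF l L symA bA]) simp
    moreover have eq: "fejer_mean l n (mcoef l Qn) x
        = fejer_mean l n (\<lambda>k. expop \<tau> (M k) (A k)) x + fejer_mean l n J x"
      unfolding fejer_mean_add[symmetric] cn[symmetric] ..
    ultimately show ?thesis
      unfolding eq using norm_triangle_ineq[of "fejer_mean l n (\<lambda>k. expop \<tau> (M k) (A k)) x" "fejer_mean l n J x"]
      by linarith
  qed
  from fejer_mean_bound_imp_AE_norm_le[OF l Qn this] show ?thesis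
    using Qn symn by (simp add: bounded_sym_def)
qed

text \<open>Interpolation between two equal terms is constant in s. Thus one step lemma covers ETD1,
  the predictor and the corrector.\<close>

lemma etd1_step_conv_etdrk2_step:
  "etd1_step l L1 L4 \<kappa>1 \<kappa>2 \<alpha> \<beta> \<gamma> \<tau> Qm Qn \<longleftrightarrow> etdrk2_step l L1 L4 \<kappa>1 \<kappa>2 \<alpha> \<beta> \<gamma> \<tau> Qm Qm Qn"
  unfolding etd1_step_def etdrk2_step_def scaleR_left_distrib[symmetric] by simp

lemma admissible_integrable:
  assumes "admissible l \<kappa>1 \<kappa>2 \<alpha> \<beta> \<gamma> Q"
  shows "integrable (boxm l) Q" "integrable (boxm l) (\<lambda>x. Nop \<kappa>1 \<kappa>2 \<alpha> \<beta> \<gamma> (Q x))"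
  using assms by (auto simp: admissible_def set_integrable_boxm intro!: integrable_matI)

theorem theorem3p4:
  fixes L1 L4 \<alpha> \<beta> \<gamma> \<kappa>2 :: real
  assumes "L1 > 0" and "\<gamma> > 0" and "\<kappa>2 \<ge> L4\<^sup>2 / (2 * L1)"
  shows "\<exists>a0>0. \<forall>a \<ge> a0. \<forall>(l :: real^3) \<kappa>1 (Q0 :: real^3 \<Rightarrow> rmat) \<tau>.
     (let b = \<beta>\<^sup>2 / \<gamma>\<^sup>2 - 2 * (\<alpha> - \<kappa>2) / \<gamma>;
          Cf = \<bar>\<alpha>\<bar> + \<bar>\<beta>\<bar> * a + \<gamma> * a\<^sup>2 + \<gamma> * \<bar>b\<bar>
      in (\<forall>j. l $ j > 0) \<longrightarrow> b < a\<^sup>2 \<longrightarrow>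
         \<kappa>1 \<ge> (\<kappa>2 + Cf)\<^sup>2 / (\<gamma> * (a\<^sup>2 - b)) \<longrightarrow>
         inZ l Q0 \<longrightarrow>
         (AE x in lborel. x \<in> Omega l \<longrightarrow> (frob (Q0 x))\<^sup>2 \<le> a\<^sup>2) \<longrightarrow>
         \<tau> > 0 \<longrightarrow>
         (\<forall>Q. Q 0 = Q0 \<longrightarrow>
              (is_etd1_seq l L1 L4 \<kappa>1 \<kappa>2 \<alpha> \<beta> \<gamma> \<tau> Q
               \<or> (\<exists>Qt. is_etdrk2_seq l L1 L4 \<kappa>1 \<kappa>2 \<alpha> \<beta> \<gamma> \<tau> Q Qt)) \<longrightarrow>
              (\<forall>m. AE x in lborel. x \<in> Omega l \<longrightarrow> (frob (Q m x))\<^sup>2 \<le> a\<^sup>2)))"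
  unfolding Let_def
\<comment> \<open>The threshold 1 supplies a > 0; largeness relative to the coefficients enters
  through b < a^2.\<close>
proof (rule exI[of _ 1], intro conjI allI impI)
  fix a :: real and l :: "real^3" and \<kappa>1 \<tau> :: real and Q0 :: "real^3 \<Rightarrow> rmat"
    and Q :: "nat \<Rightarrow> real^3 \<Rightarrow> rmat" and m :: nat
  let ?b = "\<beta>\<^sup>2 / \<gamma>\<^sup>2 - 2 * (\<alpha> - \<kappa>2) / \<gamma>"
  assume "1 \<le> a" and l: "\<forall>j. 0 < l $ j" and b: "?b < a\<^sup>2"
    and \<kappa>1: "(\<kappa>2 + (\<bar>\<alpha>\<bar> + \<bar>\<beta>\<bar> * a + \<gamma> * a\<^sup>2 + \<gamma> * \<bar>?b\<bar>))\<^sup>2 / (\<gamma> * (a\<^sup>2 - ?b)) \<le> \<kappa>1"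
    and Z: "inZ l Q0" and Q0: "AE x in lborel. x \<in> Omega l \<longrightarrow> (frob (Q0 x))\<^sup>2 \<le> a\<^sup>2"
    and "0 < \<tau>" and "Q 0 = Q0"
    and seq: "is_etd1_seq l L1 L4 \<kappa>1 \<kappa>2 \<alpha> \<beta> \<gamma> \<tau> Q
               \<or> (\<exists>Qt. is_etdrk2_seq l L1 L4 \<kappa>1 \<kappa>2 \<alpha> \<beta> \<gamma> \<tau> Q Qt)"
  have a: "a > 0" using \<open>1 \<le> a\<close> by simp
  have \<kappa>2: "\<kappa>2 \<ge> 0"
  proof -
    have "0 \<le> L4\<^sup>2 / (2 * L1)" using assms(1) by simp
    then show ?thesis using assms(3) by linarith
  qed
  have sq: "(frob A)\<^sup>2 \<le> a\<^sup>2 \<longleftrightarrow> norm A \<le> a" for A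
    unfolding frob_eq_norm using a by (simp add: power2_le_iff_abs_le)
  have N: "bounded_sym l (\<kappa>1 * a) (\<lambda>x. Nop \<kappa>1 \<kappa>2 \<alpha> \<beta> \<gamma> (P x))"
    if "bounded_sym l a P" "admissible l \<kappa>1 \<kappa>2 \<alpha> \<beta> \<gamma> P" for P
    unfolding bounded_sym_def
  proof (intro conjI)
    have P: "AE x in boxm l. transpose (P x) = P x" "AE x in boxm l. norm (P x) \<le> a"
      using that by (auto simp: bounded_sym_def)
    show "integrable (boxm l) (\<lambda>x. Nop \<kappa>1 \<kappa>2 \<alpha> \<beta> \<gamma> (P x))"
      by (rule admissible_integrable[OF that(2)])
    show "AE x in boxm l. transpose (Nop \<kappa>1 \<kappa>2 \<alpha> \<beta> \<gamma> (P x)) = Nop \<kappa>1 \<kappa>2 \<alpha> \<beta> \<gamma> (P x)"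
      using P(1) by eventually_elim (rule transpose_Nop)
    show "AE x in boxm l. norm (Nop \<kappa>1 \<kappa>2 \<alpha> \<beta> \<gamma> (P x)) \<le> \<kappa>1 * a"
      using P by eventually_elim (rule norm_Nop_le[OF _ _ a assms(2) \<kappa>2 refl b \<kappa>1])
  qed
  have step: "bounded_sym l a Qn"
    if "bounded_sym l a Qm" "bounded_sym l a Qt" "admissible l \<kappa>1 \<kappa>2 \<alpha> \<beta> \<gamma> Qm"
      "admissible l \<kappa>1 \<kappa>2 \<alpha> \<beta> \<gamma> Qt" "admissible l \<kappa>1 \<kappa>2 \<alpha> \<beta> \<gamma> Qn"
      "etdrk2_step l L1 L4 \<kappa>1 \<kappa>2 \<alpha> \<beta> \<gamma> \<tau> Qm Qt Qn" for Qm Qt Qn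
    using l that
    by (intro etdrk2_step_preserves[OF _ assms(1,3) \<open>0 < \<tau>\<close> that(1) N N _ that(6)])
      (auto dest: admissible_integrable)
  have adm: "admissible l \<kappa>1 \<kappa>2 \<alpha> \<beta> \<gamma> (Q m)" for m
    using seq by (auto simp: is_etd1_seq_def is_etdrk2_seq_def)
  have "bounded_sym l a (Q m)" for m
  proof (induction m)
    case 0
    show ?case
      unfolding bounded_sym_def \<open>Q 0 = Q0\<close>
    proof (intro conjI)
      show "integrable (boxm l) Q0" using admissible_integrable[OF adm[of 0]] \<open>Q 0 = Q0\<close> by simp
      have "AE x in lborel. x \<in> Omega l \<longrightarrow> sym_traceless (Q0 x)" using Z by (simp add: inZ_def)
      then show "AE x in boxm l. transpose (Q0 x) = Q0 x"
        unfolding AE_boxm by eventually_elim (simp add: sym_traceless_def)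
      show "AE x in boxm l. norm (Q0 x) \<le> a" using Q0 by (simp add: AE_boxm sq)
    qed
  next
    case (Suc m)
    from seq show ?case
    proof (elim disjE exE)
      assume "is_etd1_seq l L1 L4 \<kappa>1 \<kappa>2 \<alpha> \<beta> \<gamma> \<tau> Q"
      then show ?thesis
        unfolding is_etd1_seq_def etd1_step_conv_etdrk2_step by (blast intro: step Suc adm)
    next
      fix Qt assume Qt: "is_etdrk2_seq l L1 L4 \<kappa>1 \<kappa>2 \<alpha> \<beta> \<gamma> \<tau> Q Qt"
      then have t: "admissible l \<kappa>1 \<kappa>2 \<alpha> \<beta> \<gamma> (Qt (Suc m))"
        "etdrk2_step l L1 L4 \<kappa>1 \<kappa>2 \<alpha> \<beta> \<gamma> \<tau> (Q m) (Q m) (Qt (Suc m))"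
        "etdrk2_step l L1 L4 \<kappa>1 \<kappa>2 \<alpha> \<beta> \<gamma> \<tau> (Q m) (Qt (Suc m)) (Q (Suc m))"
        unfolding is_etdrk2_seq_def etd1_step_conv_etdrk2_step by blast+
      \<comment> \<open>The predictor of step m carries the index \<open>Suc m\<close>. As an ETD1
        step it satisfies the invariant, which makes it a legitimate second argument of the
        corrector.\<close>
      have "bounded_sym l a (Qt (Suc m))" by (rule step[OF Suc Suc adm adm t(1,2)])
      then show ?thesis by (rule step[OF Suc _ adm t(1) adm t(3)])
    qed
  qed
  then show "AE x in lborel. x \<in> Omega l \<longrightarrow> (frob (Q m x))\<^sup>2 \<le> a\<^sup>2"
    by (simp add: bounded_sym_def AE_boxm sq)
qed simp

end
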